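(* Consider the non-uniform Kuramoto model $$D_i\dot\theta_i=\omega_i-\sum_{j=1}^nP_{ij}\sin(\theta_i-\theta_j+\varphi_{ij}),\quad i\in\{1,\dots,n\},$$ where the graph induced by $P$ has a globally reachable node, $\varphi_{\max}=0$, and $\omega_i/D_i=\bar\omega$ for all $i\in\{1,\dots,n\}$. Then for every $\theta(0)\in\bar\Delta(\gamma)$ with $\gamma\in[0,\pi[$: 1) the phases $\theta_i(t)$ synchronize exponentially to $\theta_\infty(t)\in[\theta_{\min}(0),\theta_{\max}(0)]+\bar\omega t$; and 2) if $P=P^T$, then the phases $\theta_i(t)$ synchronize exponentially to the weighted mean angle $\theta_\infty(t)=\sum_iD_i\theta_i(0)/\sum_iD_i+\bar\omega t$ at a rate no worse than $$\lambda_{\mathrm{ps}}=-\lambda_2(L(P_{ij}))\,\mathrm{sinc}(\gamma)\cos(\angle(D\mathbf 1,\mathbf 1))^2/D_{\max},$$ i.e., the vector of deviations $\theta_i(t)-\theta_\infty(t)$ has Euclidean norm at most $Ce^{\lambda_{\mathrm{ps}}t}$ for all $t\ge0$ and some constant $C$.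
   Context: Parameters: $D_i>0$, $\omega_i\in\mathbb R$, $P_{ij}\ge0$ (some may be zero and $P$ need not be symmetric), $P_{ii}=0$, phase shifts $\varphi_{ij}\in[0,\pi/2[$ with $\varphi_{\max}=\max_{i,j}\varphi_{ij}$ (so here all $\varphi_{ij}=0$). $D=\mathrm{diag}(D_i)$, $D_{\max}=\max_iD_i$; $\mathbf 1$ is the vector of ones; $\angle(x,y)\in[0,\pi/2]$ with $\cos\angle(x,y)=x^Ty/(\|x\|\|y\|)$; $\mathrm{sinc}(x)=\sin(x)/x$ (with $\mathrm{sinc}(0)=1$). The graph induced by a nonnegative matrix $P$ is the weighted directed graph on $\{1,\dots,n\}$ with a directed edge $(i,j)$ of weight $P_{ij}$ whenever $P_{ij}>0$; a node is globally reachable if there is a directed path to it from every other node. $L(P_{ij})=\mathrm{diag}(\sum_jP_{ij})-P$ is the Laplacian and, for $P=P^T$, $\lambda_2$ is its second-smallest eigenvalue. Geometry: $\mathbb T^1=\,]-\pi,\pi]$ with $\pm\pi$ identified, $\mathbb T^n$ the $n$-torus. An arc is a connected subset of $\mathbb T^1$. For $\gamma\in[0,\pi]$, $\Delta(\gamma)\subset\mathbb T^n$ is the set of $\theta$ such that there exists an arc of length $\gamma$ containing all $\theta_i$ in its interior; $\bar\Delta(\gamma)$ is the union of $\{\theta:\theta_i=\theta_j\ \forall i,j\}$ and the closure of $\Delta(\gamma)$. For $\theta(0)\in\bar\Delta(\gamma)$ with $\gamma<\pi$ all angles lie in an open half-circle; $\theta_{\min}(0)$ and $\theta_{\max}(0)$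 are the counterclockwise minimum and maximum of the initial angles, $[\theta_{\min}(0),\theta_{\max}(0)]$ is the arc between them, and the weighted average of the angles is well defined (computed in this arc). "Synchronize exponentially to $\theta_\infty(t)$" means that $\theta_i(t)-\theta_\infty(t)\to0$ exponentially fast as $t\to\infty$ for all $i$; here $\theta_\infty(t)-\bar\omega t$ is constant. *)

theory Defs
  imports
    "HOL-Analysis.Analysis"
    "HOL-Probability.Sinc_Integral"
    "HOL-Computational_Algebra.Polynomial"
begin

subsection \<open>The torus\<close>

text \<open>
  The circle \<open>]-\<pi>, \<pi>]\<close> with \<open>\<plusminus>\<pi>\<close> identified is represented by the complex unit circle
  via \<open>x \<mapsto> cis x\<close>, and the torus by the vectors all of whose components lie on the unit circle.
\<close>

definition circle :: "complex set" where
  "circle = sphere 0 1"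

definition torus :: "(complex ^ 'n) set" where
  "torus = {z. \<forall>i. z $ i \<in> circle}"

definition is_arc :: "complex set \<Rightarrow> bool" where
  "is_arc A \<longleftrightarrow> A \<subseteq> circle \<and> connected A"

definition arc_length :: "complex set \<Rightarrow> real" where
  "arc_length A = measure lebesgue {x \<in> {-pi<..pi}. cis x \<in> A}"

definition Delta :: "real \<Rightarrow> (complex ^ 'n) set" where
  "Delta \<gamma> = {z. \<exists>A. is_arc A \<and> arc_length A = \<gamma> \<and>
                 (\<forall>i. z $ i \<in> (top_of_set circle) interior_of A)}"

text \<open>The torus is closed, so the closure may be taken in the ambient space.\<close>

definition Delta_bar :: "real \<Rightarrow> (complex ^ 'n) set" where
  "Delta_bar \<gamma> = {z \<in> torus. \<forall>i j. z $ i = z $ j} \<union> closure (Delta \<gamma>)"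

text \<open>
  Real coordinates for angles lying in a common open half-circle: \<open>x\<close> represents \<open>z\<close> and all
  components of \<open>x\<close> are taken within an interval of length less than \<open>\<pi>\<close>. Such an \<open>x\<close> is unique
  up to adding one common multiple of \<open>2\<pi>\<close> to all components. Increasing coordinates run
  counterclockwise, so the least and the greatest component of \<open>x\<close> are the counterclockwise
  minimum and maximum, and the arc between them is the real interval they span.
\<close>

definition half_circle_coords :: "complex ^ 'n \<Rightarrow> real ^ 'n \<Rightarrow> bool" where
  "half_circle_coords z x \<longleftrightarrow>
     (\<forall>i. cis (x $ i) = z $ i) \<and> (\<forall>i j. \<bar>x $ i - x $ j\<bar> < pi)"

definition angle_min :: "real ^ 'n \<Rightarrow> real" where
  "angle_min x = Min (range (($) x))"

definition angle_max :: "real ^ 'n \<Rightarrow> real" where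
  "angle_max x = Max (range (($) x))"

definition weighted_mean :: "real ^ 'n \<Rightarrow> real ^ 'n \<Rightarrow> real" where
  "weighted_mean D x = (\<Sum>i\<in>UNIV. D $ i * x $ i) / (\<Sum>i\<in>UNIV. D $ i)"

subsection \<open>Graphs and matrices\<close>

definition graph_edges :: "real ^ 'n ^ 'n \<Rightarrow> ('n \<times> 'n) set" where
  "graph_edges P = {(i, j). P $ i $ j > 0}"

definition globally_reachable :: "real ^ 'n ^ 'n \<Rightarrow> 'n \<Rightarrow> bool" where
  "globally_reachable P k \<longleftrightarrow> (\<forall>i. i \<noteq> k \<longrightarrow> (i, k) \<in> (graph_edges P)\<^sup>+)"

definition diag :: "real ^ 'n \<Rightarrow> real ^ 'n ^ 'n" where
  "diag d = (\<chi> i j. if i = j then d $ i else 0)"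

definition laplacian :: "real ^ 'n ^ 'n \<Rightarrow> real ^ 'n ^ 'n" where
  "laplacian P = diag (\<chi> i. \<Sum>j\<in>UNIV. P $ i $ j) - P"

definition charpoly :: "real ^ 'n ^ 'n \<Rightarrow> real poly" where
  "charpoly A = det (\<chi> i j. (if i = j then [:0, 1:] else 0) - [:A $ i $ j:])"

text \<open>
  The second-smallest real eigenvalue, counted with multiplicity; only meaningful for
  matrices with at least two real eigenvalues (list indices start at 0).
\<close>

definition lambda2 :: "real ^ 'n ^ 'n \<Rightarrow> real" where
  "lambda2 A = sorted_list_of_multiset (proots (charpoly A)) ! 1"

definition vangle :: "'a::real_inner \<Rightarrow> 'a \<Rightarrow> real" where
  "vangle x y = arccos (x \<bullet> y / (norm x * norm y))"

subsection \<open>The non-uniform Kuramoto model\<close>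

definition phi_max :: "real ^ 'n ^ 'n \<Rightarrow> real" where
  "phi_max \<phi> = Max (range (\<lambda>(i, j). \<phi> $ i $ j))"

definition D_max :: "real ^ 'n \<Rightarrow> real" where
  "D_max D = Max (range (($) D))"

text \<open>
  A trajectory on the torus is described by a lift to \<open>\<real>\<^sup>n\<close>. Lifts of the same trajectory differ by
  constants in \<open>2\<pi>\<int>\<^sup>n\<close> and solve the same equations, see \<open>kuramoto_solution_shift\<close> below.
\<close>

definition kuramoto_solution ::
  "real ^ 'n \<Rightarrow> real ^ 'n \<Rightarrow> real ^ 'n ^ 'n \<Rightarrow> real ^ 'n ^ 'n \<Rightarrow> (real \<Rightarrow> real ^ 'n) \<Rightarrow> bool" where
  "kuramoto_solution D \<omega> P \<phi> \<theta> \<longleftrightarrow>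
     (\<exists>\<theta>'. \<forall>t\<ge>0. (\<theta> has_vector_derivative \<theta>' t) (at t within {0..}) \<and>
        (\<forall>i. D $ i * \<theta>' t $ i =
              \<omega> $ i - (\<Sum>j\<in>UNIV. P $ i $ j * sin (\<theta> t $ i - \<theta> t $ j + \<phi> $ i $ j))))"

lemma kuramoto_solution_shift:
  assumes "kuramoto_solution D \<omega> P \<phi> \<theta>"
  shows "kuramoto_solution D \<omega> P \<phi> (\<lambda>t. \<theta> t + (\<chi> i. 2 * pi * of_int (k i)))"
proof -
  have s: "sin (a + 2 * pi * of_int (k i) - (b + 2 * pi * of_int (k j)) + c) = sin (a - b + c)"
    for a b c :: real and i j
  proof -
    have "a + 2 * pi * of_int (k i) - (b + 2 * pi * of_int (k j)) + c
        = (a - b + c) + 2 * pi * of_int (k i - k j)"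
      by (simp add: algebra_simps)
    then show ?thesis
      by (simp only: sin_add sin_int_2pin cos_int_2pin) simp
  qed
  from assms show ?thesis
    unfolding kuramoto_solution_def
    by (auto simp: s has_vector_derivative_add_const)
qed

definition sync_exponentially :: "(real \<Rightarrow> real ^ 'n) \<Rightarrow> (real \<Rightarrow> real) \<Rightarrow> bool" where
  "sync_exponentially \<theta> \<psi> \<longleftrightarrow>
     (\<forall>i. \<exists>C \<mu>. \<mu> > 0 \<and> (\<forall>t\<ge>0. \<bar>\<theta> t $ i - \<psi> t\<bar> \<le> C * exp (- \<mu> * t)))"

definition lambda_ps :: "real ^ 'n \<Rightarrow> real ^ 'n ^ 'n \<Rightarrow> real \<Rightarrow> real" where
  "lambda_ps D P \<gamma> =
     - lambda2 (laplacian P) * sinc \<gamma> * (cos (vangle (diag D *v 1) 1))\<^sup>2 / D_max D"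

end

theory Submission
  imports Defs
begin

text \<open>
  In a frame rotating with the common frequency the model becomes a diffusive coupling
  \<open>y\<^sub>i' = \<Sum>\<^sub>j a\<^sub>i\<^sub>j sin (y\<^sub>j - y\<^sub>i)\<close> with nonnegative rates. A point of \<open>Delta_bar \<gamma>\<close> has real coordinates
  of spread at most \<open>\<gamma> < pi\<close>, because a connected proper subset of the circle, cut open at a
  missing point, is an interval of the same length (\<open>arc_coordinates\<close>, \<open>Delta_bar_coords\<close>).

  As long as all angles lie in an open half-circle the extreme ones are pulled inwards, so the interval
  spanned by the angles never grows (\<open>coupled_le_max\<close>). On it the sine lies above a linear function of
  slope \<open>sinc \<gamma> > 0\<close>, and a globally reachable node \<open>k\<close> influences every other node within a uniform
  time: each angle is moved away from the maximum in proportion to the distance of \<open>k\<close> from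
  the maximum, and likewise for the minimum (\<open>coupled_gap_reach\<close>). The sum of the two effects shrinks the
  spread by a fixed factor (\<open>coupled_contraction\<close>). Nested intervals of exponentially decreasing length
  give the limit in the initial interval (\<open>coupled_synchronizes\<close>).

  For symmetric \<open>P\<close> the interactions cancel in the \<open>D\<close>-weighted mean, which is therefore constant and must
  be the limit (\<open>coupled_weighted_mean\<close>). With \<open>e\<close> the vector of deviations from it, the energy
  \<open>\<Sum>\<^sub>i D\<^sub>i e\<^sub>i\<^sup>2\<close> has derivative at most \<open>- 2 * sinc \<gamma>\<close> times the Laplacian form of \<open>e\<close>.
  On the complement of \<open>1\<close> that form is at least \<open>lambda2\<close> times the squared norm
  (\<open>lambda2_le_rayleigh\<close>); since \<open>e\<close> is orthogonal to \<open>D\<close> instead of \<open>1\<close>, the squared cosine of the angle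
  between these two vectors enters (\<open>weighted_laplacian_rayleigh\<close>), and \<open>D_max\<close> enters when the norm is
  compared with the energy. The resulting linear differential inequality gives the rate
  (\<open>coupled_energy_decay\<close>).
\<close>

section \<open>Angle coordinates of configurations in an arc\<close>

text \<open>
  The window \<open>]b - pi, b + pi[\<close> of angles omits only the point opposite to \<open>cis b\<close>. Moving the part of
  \<open>I\<close> beyond \<open>pi\<close> back by \<open>2 pi\<close> turns angles in this window into angles in \<open>]-pi, pi]\<close>.
\<close>

lemma arc_length_eq_measure_coordinates:
  assumes I: "I = {x \<in> {b - pi<..<b + pi}. cis x \<in> A}" and b: "0 \<le> b" "b < 2 * pi"
    and miss: "- cis b \<notin> A" and meas: "I \<in> lmeasurable"
  shows "arc_length A = measure lebesgue I"
proof -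
  define I1 I2 where "I1 = I \<inter> {..pi}" and "I2 = I \<inter> {pi<..}"
  have m: "I1 \<in> lmeasurable" "I2 \<in> lmeasurable"
    using meas by (auto simp: I1_def I2_def intro!: fmeasurable_Int_fmeasurable)
  have per: "cis (x - 2 * pi) = cis x" for x
    by (simp flip: cis_divide)
  have mem: "x \<in> {-pi<..pi} \<and> cis x \<in> A \<longleftrightarrow> x \<in> I1 \<or> x + 2 * pi \<in> I2" for x
  proof -
    have "cis (x + 2 * pi) = cis x" using per[of "x + 2 * pi"] by simp
    moreover have "x \<noteq> b - pi \<and> x \<noteq> b + pi" if "cis x \<in> A"
      using that miss by (auto simp flip: cis_mult cis_divide)
    ultimately show ?thesis
      using b by (auto simp: I1_def I2_def I)
  qed
  have "x \<in> (+) (- 2 * pi) ` I2 \<longleftrightarrow> x + 2 * pi \<in> I2" for x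
    by (auto intro: image_eqI[of _ _ "x + 2 * pi"])
  then have "{x \<in> {-pi<..pi}. cis x \<in> A} = I1 \<union> (+) (- 2 * pi) ` I2"
    unfolding set_eq_iff Un_iff mem_Collect_eq mem by blast
  moreover have "I1 \<inter> (+) (- 2 * pi) ` I2 = {}"
    by (auto simp: I1_def I2_def I)
  ultimately have "arc_length A = measure lebesgue I1 + measure lebesgue ((+) (- 2 * pi) ` I2)"
    unfolding arc_length_def using m
    by (simp only: measure_Un3[OF m(1) measurable_translation[OF m(2)]]) simp
  also have "measure lebesgue ((+) (- 2 * pi) ` I2) = measure lebesgue I2"
    by (rule measure_translation)
  also have "measure lebesgue I1 + measure lebesgue I2 = measure lebesgue (I1 \<union> I2)"
  proof -
    have "I1 \<inter> I2 = {}" by (auto simp: I1_def I2_def)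
    then show ?thesis by (simp add: measure_Un3[OF m])
  qed
  also have "I1 \<union> I2 = I"
    by (auto simp: I1_def I2_def)
  finally show ?thesis .
qed

text \<open>
  An arc that is not the full circle misses some point. Cutting the circle there gives a continuous
  angle \<open>f\<close> on the arc; by connectedness its values form an interval, whose length is the arc length.
\<close>

lemma arc_coordinates:
  assumes A: "is_arc A" and len: "arc_length A < 2 * pi"
  obtains f where "\<And>z. z \<in> A \<Longrightarrow> cis (f z) = z"
    "\<And>z w. z \<in> A \<Longrightarrow> w \<in> A \<Longrightarrow> f z - f w \<le> arc_length A"
proof -
  have "A \<subseteq> circle" using A by (simp add: is_arc_def)
  have "A \<noteq> circle"
  proof
    assume "A = circle"
    then have "{x \<in> {-pi<..pi}. cis x \<in> A} = {-pi<..pi}" by (auto simp: circle_def)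
    then show False using len by (simp add: arc_length_def)
  qed
  then obtain p where p: "p \<in> circle" "p \<notin> A" using \<open>A \<subseteq> circle\<close> by auto
  define b where "b = Arg2pi (- p)"
  have b: "0 \<le> b" "b < 2 * pi" "- cis b = p"
    using p(1) Arg2pi_ge_0[of "- p"] Arg2pi_lt_2pi[of "- p"] Arg2pi_eq[of "- p"]
    by (auto simp: b_def circle_def cis_conv_exp)
  define f where "f z = b + Arg (z * cis (- b))" for z
  have norm: "norm z = 1" if "z \<in> A" for z
    using that \<open>A \<subseteq> circle\<close> by (auto simp: circle_def)
  have cis_f: "cis (f z) = z" if "z \<in> A" for z
  proof -
    have "cis (Arg (z * cis (- b))) = sgn (z * cis (- b))"
      using norm[OF that] by (intro cis_Arg) auto
    then show ?thesis
      using norm[OF that] by (simp add: f_def sgn_div_norm norm_mult flip: cis_mult) (simp add: cis_mult)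
  qed
  have off: "z * cis (- b) \<notin> \<real>\<^sub>\<le>\<^sub>0" if "z \<in> A" for z
  proof
    assume "z * cis (- b) \<in> \<real>\<^sub>\<le>\<^sub>0"
    then obtain r where r: "r \<le> 0" "z * cis (- b) = of_real r" by (auto elim: nonpos_Reals_cases)
    have "norm (z * cis (- b)) = 1" using norm[OF that] by (simp add: norm_mult)
    then have "r = - 1" using r by simp
    then have "z * (cis (- b) * cis b) = - cis b" using r by (simp add: mult.assoc[symmetric])
    then have "z = - cis b" by (simp add: cis_mult)
    then show False using b(3) p(2) that by simp
  qed
  have f_range: "b - pi < f z" "f z < b + pi" if "z \<in> A" for z
    using mpi_less_Arg[of "z * cis (- b)"] Arg_le_pi[of "z * cis (- b)"] off[OF that]
      Arg_lt_pi[of "z * cis (- b)"] norm[OF that]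
    by (auto simp: f_def complex_nonpos_Reals_iff less_le Arg_eq_pi_iff complex_is_Real_iff)
  define I where "I = {x \<in> {b - pi<..<b + pi}. cis x \<in> A}"
  have "I = f ` A"
  proof (intro equalityI subsetI)
    fix x assume x: "x \<in> I"
    have "f (cis x) = x"
      using x by (simp add: f_def I_def cis_mult Arg_cis)
    then show "x \<in> f ` A" using x by (force simp: I_def)
  qed (use cis_f f_range in \<open>auto simp: I_def\<close>)
  moreover have "continuous_on A f"
    unfolding f_def using off by (intro continuous_intros) auto
  ultimately have "connected I"
    using A by (auto simp: is_arc_def intro: connected_continuous_image)
  have "convex I" using \<open>connected I\<close> by (simp add: is_interval_connected_1 flip: is_interval_convex_1)
  moreover have "bounded I" by (rule bounded_subset[of "{b - pi..b + pi}"]) (auto simp: I_def)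
  ultimately have meas: "I \<in> lmeasurable" by (rule measurable_convex)
  have len: "arc_length A = measure lebesgue I"
    using b p meas by (intro arc_length_eq_measure_coordinates[OF I_def]) auto
  have "f z - f w \<le> arc_length A" if "z \<in> A" "w \<in> A" for z w
  proof (cases "f w \<le> f z")
    case True
    have "{f w..f z} \<subseteq> I"
      using \<open>connected I\<close> that unfolding \<open>I = f ` A\<close> by (intro connected_contains_Icc) auto
    then have "measure lebesgue {f w..f z} \<le> measure lebesgue I"
      using meas by (intro measure_mono_fmeasurable) auto
    then show ?thesis using True len by simp
  next
    case False
    then show ?thesis
      using measure_nonneg[of lebesgue I] len by linarith
  qed
  then show ?thesis using that cis_f by blast
qed

text \<open>
  The closure in the definition of \<open>Delta_bar\<close> creates no new difficulty: the configurations that have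
  coordinates of spread at most \<open>\<gamma>\<close> form the image of a compact set, once a common rotation by a
  multiple of \<open>2 pi\<close> has brought one chosen coordinate into \<open>[-pi, pi]\<close>.
\<close>

lemma Delta_bar_coords:
  fixes z :: "complex^'n"
  assumes \<gamma>: "0 \<le> \<gamma>" "\<gamma> < pi" and z: "z \<in> Delta_bar \<gamma>"
  obtains x :: "real^'n" where "\<And>i. cis (x $ i) = z $ i" "\<And>i j. x $ i - x $ j \<le> \<gamma>"
proof -
  define k :: 'n where "k = undefined"
  define X where "X = {x :: real^'n. \<bar>x $ k\<bar> \<le> pi \<and> (\<forall>i j. x $ i - x $ j \<le> \<gamma>)}"
  define g where "g x = (\<chi> i. cis (x $ i))" for x :: "real^'n"
  have "closed X"
    unfolding X_def by (intro closed_Collect_conj closed_Collect_all closed_Collect_le continuous_intros)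
  moreover have "bounded X"
  proof (rule boundedI)
    fix x assume "x \<in> X"
    then have "\<bar>x $ i\<bar> \<le> 2 * pi" for i
      using \<gamma> spec[of "\<lambda>j. x $ i - x $ j \<le> \<gamma>" k] by (simp add: X_def) (smt (verit))
    then have "(\<Sum>i\<in>UNIV. \<bar>x $ i\<bar>) \<le> (\<Sum>i\<in>(UNIV::'n set). 2 * pi)" by (intro sum_mono) auto
    then show "norm x \<le> (\<Sum>i\<in>(UNIV::'n set). 2 * pi)"
      using norm_le_l1_cart[of x] by simp
  qed
  ultimately have "compact X" by (simp add: compact_eq_bounded_closed)
  moreover have "continuous_on X g"
    unfolding g_def by (intro continuous_on_vec_lambda continuous_intros)
  ultimately have "closed (g ` X)"
    by (intro compact_imp_closed compact_continuous_image)
  have into: "y \<in> g ` X" if x: "\<And>i. cis (x i) = y $ i" "\<And>i j. x i - x j \<le> \<gamma>" for x and y :: "complex^'n"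
  proof -
    define d where "d = Arg (cis (x k)) - x k"
    have "cis d = 1"
      using cis_Arg[of "cis (x k)"] by (simp add: d_def flip: cis_divide)
    have "g (\<chi> i. x i + d) = y"
      by (simp add: g_def x(1) \<open>cis d = 1\<close> vec_eq_iff flip: cis_mult)
    moreover have "(\<chi> i. x i + d) \<in> X"
      using x(2) mpi_less_Arg[of "cis (x k)"] Arg_le_pi[of "cis (x k)"] by (simp add: X_def d_def)
    ultimately show ?thesis by blast
  qed
  have "Delta \<gamma> \<subseteq> g ` X"
  proof
    fix y :: "complex^'n" assume "y \<in> Delta \<gamma>"
    then obtain A where A: "is_arc A" "arc_length A = \<gamma>" "\<And>i. y $ i \<in> A"
      using interior_of_subset[of "top_of_set circle"] unfolding Delta_def by blast
    then obtain f where "\<And>z. z \<in> A \<Longrightarrow> cis (f z) = z" "\<And>z w. z \<in> A \<Longrightarrow> w \<in> A \<Longrightarrow> f z - f w \<le> \<gamma>"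
      using arc_coordinates[of A] \<gamma> by auto
    then show "y \<in> g ` X"
      using A(3) by (intro into[of "\<lambda>i. f (y $ i)"]) auto
  qed
  then have "closure (Delta \<gamma>) \<subseteq> g ` X"
    using \<open>closed (g ` X)\<close> by (rule closure_minimal)
  moreover have "z \<in> g ` X" if "z \<in> torus" "\<And>i j. z $ i = z $ j"
  proof (rule into[of "\<lambda>i. Arg (z $ i)"])
    have "norm (z $ i) = 1" for i
      using that(1) by (simp add: torus_def circle_def)
    then show "cis (Arg (z $ i)) = z $ i" for i
      using cis_Arg[of "z $ i"] by (metis norm_zero sgn_div_norm inverse_1 scaleR_one zero_neq_one)
    show "Arg (z $ i) - Arg (z $ j) \<le> \<gamma>" for i j
      using that(2)[of i j] \<gamma> by simp
  qed
  ultimately have "z \<in> g ` X"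
    using z by (auto simp: Delta_bar_def)
  then show ?thesis
    using that unfolding g_def X_def by auto
qed

lemma cis_diff_unique:
  assumes "cis a = cis b" "cis c = cis d" "\<bar>a - c\<bar> < pi" "\<bar>b - d\<bar> < pi"
  shows "a - c = b - d"
proof -
  have "cis (a - c) = cis (b - d)"
    using assms(1,2) by (simp flip: cis_divide)
  moreover have "a - c \<in> {-pi<..pi}" "b - d \<in> {-pi<..pi}"
    using assms(3,4) by auto
  ultimately show ?thesis
    by (metis Arg_cis)
qed

lemma half_circle_coords_osc:
  assumes \<gamma>: "0 \<le> \<gamma>" "\<gamma> < pi" and z: "z \<in> Delta_bar \<gamma>" and x: "half_circle_coords z x"
  shows "x $ i - x $ j \<le> \<gamma>"
proof -
  obtain u where u: "\<And>i. cis (u $ i) = z $ i" "\<And>i j. u $ i - u $ j \<le> \<gamma>"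
    using Delta_bar_coords[OF \<gamma> z] by metis
  have "x $ i - x $ j = u $ i - u $ j"
  proof (rule cis_diff_unique)
    show "\<bar>u $ i - u $ j\<bar> < pi"
      using u(2)[of i j] u(2)[of j i] \<gamma> by linarith
  qed (use x in \<open>auto simp: half_circle_coords_def u\<close>)
  then show ?thesis using u by simp
qed

section \<open>Invariance of the hull of the angles\<close>

lemma sin_diff_swap: "sin (a - b) = - sin (b - a)" for a b :: real
  using sin_minus[of "b - a"] by simp

text \<open>
  By concavity the sine on \<open>[0, \<gamma>]\<close> lies above its chord, whose slope is \<open>sinc \<gamma>\<close>. This is where the
  factor \<open>sinc \<gamma>\<close> of the decay rate comes from.
\<close>

lemma sin_ge_chord:
  assumes "0 \<le> d" "d \<le> \<gamma>" "\<gamma> < pi"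
  shows "sinc \<gamma> * d \<le> sin d"
proof (cases "\<gamma> = 0")
  case False
  have "concave_on {0..pi} sin"
    by (rule f''_le0_imp_concave[where f' = cos and f'' = "\<lambda>x. - sin x"])
       (auto intro!: derivative_eq_intros sin_ge_zero)
  then have "(1 - d / \<gamma>) * sin 0 + d / \<gamma> * sin \<gamma> \<le> sin ((1 - d / \<gamma>) *\<^sub>R 0 + (d / \<gamma>) *\<^sub>R \<gamma>)"
    using assms False by (intro concave_onD) auto
  then show ?thesis
    using False by (simp add: field_simps)
qed (use assms in auto)

lemma sinc_pos: "0 < sinc \<gamma>" and sinc_le_1: "sinc \<gamma> \<le> 1" if "0 \<le> \<gamma>" "\<gamma> < pi"
  using that sin_gt_zero[of \<gamma>] sin_x_le_x[of \<gamma>] by (auto simp: field_simps)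

lemma mult_sin_ge_chord:
  assumes "\<bar>d\<bar> \<le> \<gamma>" "\<gamma> < pi"
  shows "sinc \<gamma> * d\<^sup>2 \<le> d * sin d"
proof -
  have "sinc \<gamma> * \<bar>d\<bar> * \<bar>d\<bar> \<le> sin \<bar>d\<bar> * \<bar>d\<bar>"
    using assms by (intro mult_right_mono sin_ge_chord) auto
  moreover have "sin \<bar>d\<bar> * \<bar>d\<bar> = d * sin d"
    by (cases "d \<ge> 0") auto
  ultimately show ?thesis
    by (simp add: power2_eq_square mult.assoc)
qed

lemma derivative_ge_imp_increment_ge:
  fixes f f' :: "real \<Rightarrow> real"
  assumes "\<And>t. 0 \<le> t \<Longrightarrow> (f has_real_derivative f' t) (at t within {0..})"
    and "0 \<le> a" "a \<le> b" "\<And>t. a \<le> t \<Longrightarrow> t \<le> b \<Longrightarrow> c \<le> f' t"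
  shows "c * (b - a) \<le> f b - f a"
proof -
  have "\<exists>x\<in>{a..b}. f b - f a = f' x * (b - a)"
    using assms(2,3) has_field_derivative_subset[OF assms(1), of _ "{a..b}"]
    by (intro mvt_very_simple) (auto simp: has_field_derivative_def)
  then show ?thesis
    using assms(3,4) by (auto intro!: mult_right_mono)
qed

text \<open>
  The model seen in a frame rotating with the common frequency: \<open>a i j\<close> plays the role of
  \<open>P $ i $ j / D $ i\<close>.
\<close>

definition coupled :: "('n::finite \<Rightarrow> 'n \<Rightarrow> real) \<Rightarrow> (real \<Rightarrow> 'n \<Rightarrow> real) \<Rightarrow> bool" where
  "coupled a y \<longleftrightarrow> (\<forall>i j. 0 \<le> a i j) \<and>
     (\<forall>t\<ge>0. \<forall>i. ((\<lambda>t. y t i) has_real_derivative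
        (\<Sum>j\<in>UNIV. a i j * sin (y t j - y t i))) (at t within {0..}))"

lemma coupled_nonneg: "coupled a y \<Longrightarrow> 0 \<le> a i j"
  and coupled_deriv: "coupled a y \<Longrightarrow> 0 \<le> t \<Longrightarrow>
    ((\<lambda>t. y t i) has_real_derivative (\<Sum>j\<in>UNIV. a i j * sin (y t j - y t i))) (at t within {0..})"
  by (auto simp: coupled_def)

lemma coupled_uminus:
  assumes "coupled a y" shows "coupled a (\<lambda>t i. - y t i)"
proof -
  have "(\<Sum>j\<in>UNIV. a i j * sin (- y t j - - y t i)) = - (\<Sum>j\<in>UNIV. a i j * sin (y t j - y t i))" for t i
    unfolding sum_negf[symmetric]
    using sin_minus[of "y t _ - y t i"] by (intro sum.cong) auto
  then show ?thesis
    using assms unfolding coupled_def by (auto intro!: DERIV_minus)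
qed

lemma coupled_shift:
  assumes "coupled a y" "0 \<le> s" shows "coupled a (\<lambda>t. y (s + t))"
proof -
  have "((\<lambda>t. y (s + t) i) has_real_derivative (\<Sum>j\<in>UNIV. a i j * sin (y (s + t) j - y (s + t) i)))
        (at t within {0..})" if "0 \<le> t" for t i
  proof -
    have "((\<lambda>t. y t i) has_real_derivative (\<Sum>j\<in>UNIV. a i j * sin (y (s + t) j - y (s + t) i)))
        (at (s + t) within (+) s ` {0..})"
      using assms that by (intro has_field_derivative_subset[OF coupled_deriv]) auto
    then have "((\<lambda>t. y t i) \<circ> (+) s has_real_derivative
        (\<Sum>j\<in>UNIV. a i j * sin (y (s + t) j - y (s + t) i)) * 1) (at t within {0..})"
      by (rule DERIV_image_chain) (auto intro!: derivative_eq_intros)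
    then show ?thesis by (simp add: o_def)
  qed
  then show ?thesis
    using assms(1) unfolding coupled_def by auto
qed

text \<open>
  An angle that reaches the slowly rising level \<open>M + e (1 + t)\<close> is then the largest one, and within
  an open half-circle all others pull it back, so its velocity is at most \<open>0 < e\<close>; it therefore was
  above the level already before.
\<close>

lemma coupled_no_first_touch:
  assumes y: "coupled a y" and e: "0 < e" and t: "0 < t"
    and before: "\<And>s. 0 \<le> s \<Longrightarrow> s < t \<Longrightarrow> y s i < M + e * (1 + s)"
    and at: "M + e * (1 + t) \<le> y t i"
    and max: "\<And>j. y t j \<le> M + e * (1 + t)"
    and half: "\<And>j. y t i - y t j < pi"
  shows False
proof -
  define f' where "f' = (\<Sum>j\<in>UNIV. a i j * sin (y t j - y t i))"
  have "f' \<le> 0"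
    unfolding f'_def
  proof (intro sum_nonpos mult_nonneg_nonpos coupled_nonneg[OF y])
    fix j
    have "0 \<le> sin (y t i - y t j)"
      using max[of j] at half[of j] by (intro sin_ge_zero) auto
    then show "sin (y t j - y t i) \<le> 0"
      using sin_minus[of "y t i - y t j"] by simp
  qed
  moreover have "((\<lambda>s. y s i - (M + e * (1 + s))) has_real_derivative f' - e) (at t within {0..})"
    using coupled_deriv[OF y, of t i] t by (auto simp: f'_def intro!: derivative_eq_intros)
  ultimately obtain d where d: "d > 0"
      "\<And>h. h > 0 \<Longrightarrow> 0 \<le> t - h \<Longrightarrow> h < d \<Longrightarrow> y t i - (M + e * (1 + t)) < y (t - h) i - (M + e * (1 + (t - h)))"
    using has_real_derivative_neg_dec_left[of "\<lambda>s. y s i - (M + e * (1 + s))" "f' - e" t "{0..}"] e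
    by force
  define h where "h = min (d / 2) (t / 2)"
  have "h > 0" "0 \<le> t - h" "h < d" "t - h < t"
    using d t by (auto simp: h_def)
  with d(2)[of h] before[of "t - h"] at show False by auto
qed

text \<open>
  Both levels have to be watched at once: the argument at the upper level uses that all angles lie in
  a half-circle, which in turn relies on the lower level not having been crossed. The slope \<open>e\<close> makes
  all inequalities strict, so that a first touching time leads to a contradiction.
\<close>

lemma coupled_hull_strict:
  assumes y: "coupled a y" and e: "0 < e"
    and init: "\<And>i. m \<le> y 0 i" "\<And>i. y 0 i \<le> M"
    and half: "M - m + 2 * e * (1 + T) < pi"
    and t: "0 \<le> t" "t \<le> T"
  shows "y t i < M + e * (1 + t)"
proof (rule ccontr)
  assume neg: "\<not> y t i < M + e * (1 + t)"
  define S where "S = (\<Union>i. {s \<in> {0..T}. M + e * (1 + s) \<le> y s i} \<union> {s \<in> {0..T}. - m + e * (1 + s) \<le> - y s i})"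
  have S_iff: "s \<in> S \<longleftrightarrow> s \<in> {0..T} \<and> (\<exists>i. M + e * (1 + s) \<le> y s i \<or> - m + e * (1 + s) \<le> - y s i)" for s
    by (auto simp: S_def)
  have cont: "continuous_on {0..T} (\<lambda>s. y s i)" for i
    by (rule continuous_on_subset[of "{0..}"])
       (auto intro!: DERIV_continuous_on coupled_deriv[OF y])
  have "closed S"
    unfolding S_def
    by (intro closed_UN ballI closed_Un continuous_on_closed_Collect_le continuous_intros cont) auto
  moreover have "bounded S"
    by (rule bounded_subset[of "{0..T}"]) (auto simp: S_def)
  ultimately have "compact S"
    by (simp add: compact_eq_bounded_closed)
  moreover have "t \<in> S"
    unfolding S_iff using neg t by (auto intro!: exI[of _ i])
  ultimately obtain s where s: "s \<in> S" "\<And>r. r \<in> S \<Longrightarrow> s \<le> r"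
    using compact_attains_inf[of S] by blast
  have sT: "0 \<le> s" "s \<le> T"
    using s(1) by (auto simp: S_def)
  have before: "y r i < M + e * (1 + r)" "- y r i < - m + e * (1 + r)" if "0 \<le> r" "r < s" for r i
  proof -
    have "r \<notin> S" using s(2)[of r] that by auto
    then show "y r i < M + e * (1 + r)" "- y r i < - m + e * (1 + r)"
      using that sT unfolding S_iff by (auto simp: not_le)
  qed
  have "s \<noteq> 0"
  proof
    assume "s = 0"
    then obtain i where "M + e \<le> y 0 i \<or> - m + e \<le> - y 0 i"
      using s(1) by (auto simp: S_iff)
    then show False using e init[of i] by auto
  qed
  then have "0 < s" using sT by simp
  have le: "f s \<le> B + e * (1 + s)"
    if "continuous_on {0..T} f" "\<And>r. 0 \<le> r \<Longrightarrow> r < s \<Longrightarrow> f r < B + e * (1 + r)" for f B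
  proof -
    have "continuous_on {0..s} f"
      using that(1) sT by (auto elim: continuous_on_subset)
    then have "closed {r \<in> {0..s}. f r \<le> B + e * (1 + r)}"
      by (intro continuous_on_closed_Collect_le continuous_intros) auto
    moreover have "{0..<s} \<subseteq> {r \<in> {0..s}. f r \<le> B + e * (1 + r)}"
      using that(2) by (force intro: less_imp_le)
    ultimately have "closure {0..<s} \<subseteq> {r \<in> {0..s}. f r \<le> B + e * (1 + r)}"
      by (rule closure_minimal[rotated])
    then show ?thesis
      using \<open>0 < s\<close> by (auto simp: subset_iff)
  qed
  have hull: "y s j \<le> M + e * (1 + s)" "- y s j \<le> - m + e * (1 + s)" for j
    using le[OF cont before(1)] le[OF continuous_on_minus[OF cont] before(2)] by auto
  have width: "M + e * (1 + s) - (m - e * (1 + s)) < pi"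
  proof -
    have "e * s \<le> e * T" using e sT by simp
    then show ?thesis using half by (simp add: algebra_simps)
  qed
  have diff: "y s i - y s j < pi" for i j
    using hull(1)[of i] hull(2)[of j] width by simp
  from s(1) obtain i where "M + e * (1 + s) \<le> y s i \<or> - m + e * (1 + s) \<le> - y s i"
    by (auto simp: S_def)
  then show False
  proof
    assume *: "M + e * (1 + s) \<le> y s i"
    show False
      by (rule coupled_no_first_touch[OF y e \<open>0 < s\<close> before(1) * hull(1) diff])
  next
    assume *: "- m + e * (1 + s) \<le> - y s i"
    show False
      by (rule coupled_no_first_touch[OF coupled_uminus[OF y] e \<open>0 < s\<close> before(2) * hull(2)])
         (use diff in auto)
  qed
qed

text \<open>
  The case \<open>e \<rightarrow> 0\<close> of the previous bound.
\<close>

lemma coupled_le_max: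
  assumes y: "coupled a y"
    and init: "\<And>i. y 0 i \<le> M" "\<And>i. m \<le> y 0 i" and half: "M - m < pi" and t: "0 \<le> t"
  shows "y t i \<le> M"
proof (rule ccontr)
  assume *: "\<not> ?thesis"
  define c where "c = min (y t i - M) (pi - (M - m))"
  \<comment> \<open>Small enough both to keep the widened hull below \<open>pi\<close> and to stay below \<open>y t i\<close>.\<close>
  define e where "e = c / (4 * (1 + t))"
  have c: "0 < c" "c \<le> y t i - M" "c \<le> pi - (M - m)"
    using * half by (auto simp: c_def)
  then have e: "0 < e" and ec: "e * (1 + t) = c / 4"
    using t by (auto simp: e_def field_simps)
  have "2 * e * (1 + t) = c / 2" using ec by simp
  then have "y t i < M + e * (1 + t)"
    using c init by (intro coupled_hull_strict[OF y e, where m = m and T = t] t) auto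
  then show False using ec c by simp
qed

lemma coupled_ge_min:
  assumes y: "coupled a y"
    and init: "\<And>i. y 0 i \<le> M" "\<And>i. m \<le> y 0 i" and half: "M - m < pi" and t: "0 \<le> t"
  shows "m \<le> y t i"
  using coupled_le_max[OF coupled_uminus[OF y], of "- m" "- M" t i] assms by simp

definition osc :: "('n::finite \<Rightarrow> real) \<Rightarrow> real" where
  "osc x = Max (range x) - Min (range x)"

lemma range_bounds: "x i \<le> Max (range x)" "Min (range x) \<le> x i" for x :: "'n::finite \<Rightarrow> real"
  by auto

lemma osc_le_iff: "osc x \<le> c \<longleftrightarrow> (\<forall>i j. x i - x j \<le> c)"
proof
  assume "osc x \<le> c"
  then show "\<forall>i j. x i - x j \<le> c"
    using range_bounds[of x] unfolding osc_def by (smt (verit))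
next
  assume *: "\<forall>i j. x i - x j \<le> c"
  have "Max (range x) \<in> range x" "Min (range x) \<in> range x"
    by (auto intro!: Max_in Min_in)
  then obtain i j where "Max (range x) = x i" "Min (range x) = x j"
    by blast
  then show "osc x \<le> c"
    using * by (simp add: osc_def)
qed

lemma diff_le_osc: "x i - x j \<le> osc x"
  using osc_le_iff by blast

lemma osc_nonneg: "0 \<le> osc x"
  using diff_le_osc[of x undefined undefined] by simp

lemma coupled_in_hull:
  assumes y: "coupled a y" and "osc (y 0) < pi" and "0 \<le> t"
  shows "Min (range (y 0)) \<le> y t i" "y t i \<le> Max (range (y 0))"
proof -
  have half: "Max (range (y 0)) - Min (range (y 0)) < pi"
    using assms(2) by (simp add: osc_def)
  show "Min (range (y 0)) \<le> y t i"
    by (rule coupled_ge_min[OF y range_bounds half \<open>0 \<le> t\<close>])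
  show "y t i \<le> Max (range (y 0))"
    by (rule coupled_le_max[OF y range_bounds half \<open>0 \<le> t\<close>])
qed

lemma coupled_in_hull_later:
  assumes y: "coupled a y" and "osc (y s) < pi" and "0 \<le> s" "s \<le> t"
  shows "Min (range (y s)) \<le> y t i" "y t i \<le> Max (range (y s))"
  using coupled_in_hull[OF coupled_shift[OF y \<open>0 \<le> s\<close>], of "t - s" i] assms by auto

lemma coupled_osc_antimono:
  assumes "coupled a y" "osc (y s) < pi" "0 \<le> s" "s \<le> t"
  shows "osc (y t) \<le> osc (y s)"
  unfolding osc_le_iff
proof (intro allI)
  fix i j show "y t i - y t j \<le> osc (y s)"
    using coupled_in_hull_later[OF assms, of i] coupled_in_hull_later[OF assms, of j]
    unfolding osc_def by linarith
qed

section \<open>Contraction of the spread\<close>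

text \<open>
  On a hull of width at most \<open>\<gamma>\<close> the coupling is bounded below by a linear one, because
  \<open>sin (u - v) \<ge> sinc \<gamma> * u - v\<close> for gaps \<open>u, v \<ge> 0\<close> to a common upper bound \<open>M\<close>. The loss term \<open>- v\<close>
  is removed by the weight \<open>exp (K t)\<close>. What remains is a sum of nonnegative terms, so the weighted gaps
  \<open>w\<close> increase, and each of them grows at least in proportion to the gap of any neighbour.
\<close>

lemma coupled_gap:
  assumes y: "coupled a y" and \<gamma>: "0 \<le> \<gamma>" "\<gamma> < pi" and osc: "osc (y 0) \<le> \<gamma>"
    and M: "\<And>i. y 0 i \<le> M"
  defines "K \<equiv> \<Sum>i\<in>UNIV. \<Sum>j\<in>UNIV. a i j"
  defines "w \<equiv> \<lambda>t i. exp (K * t) * (M - y t i)"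
  shows coupled_gap_mono: "0 \<le> s \<Longrightarrow> s \<le> t \<Longrightarrow> w s i \<le> w t i"
    and coupled_gap_edge: "0 \<le> t \<Longrightarrow> sinc \<gamma> * a i j * w t j \<le> w (t + 1) i"
proof -
  let ?\<sigma> = "sinc \<gamma>"
  have \<sigma>: "0 < ?\<sigma>" "?\<sigma> \<le> 1"
    using sinc_pos[OF \<gamma>] sinc_le_1[OF \<gamma>] .
  note a = coupled_nonneg[OF y]
  have le: "y t i \<le> M" if "0 \<le> t" for t i
  proof -
    have "y t i \<le> Max (range (y 0))"
      using that osc \<gamma> by (intro coupled_in_hull[OF y]) auto
    also have "\<dots> \<le> M" using M by auto
    finally show ?thesis .
  qed
  have nonneg: "0 \<le> w t i" if "0 \<le> t" for t i
    using le[OF that] by (simp add: w_def)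
  have osc_t: "y t i - y t j \<le> \<gamma>" if "0 \<le> t" for t i j
    using coupled_osc_antimono[OF y, of 0 t] osc \<gamma> that diff_le_osc[of "y t" i j] by simp
  have sin_ge: "?\<sigma> * (M - y t j) - (M - y t i) \<le> sin (y t i - y t j)" if "0 \<le> t" for t i j
  proof (cases "y t j \<le> y t i")
    case True
    then have "?\<sigma> * (y t i - y t j) \<le> sin (y t i - y t j)"
      using osc_t[OF that] \<gamma> by (intro sin_ge_chord) auto
    moreover have "?\<sigma> * (M - y t i) \<le> M - y t i"
      using le[OF that, of i] \<sigma> by (intro mult_left_le_one_le) auto
    moreover have "?\<sigma> * (y t i - y t j) = ?\<sigma> * (M - y t j) - ?\<sigma> * (M - y t i)"
      by (simp only: right_diff_distrib)
    ultimately show ?thesis by linarith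
  next
    case False
    then have "y t i - y t j \<le> sin (y t i - y t j)"
      using sin_x_le_x[of "y t j - y t i"] sin_minus[of "y t i - y t j"] by simp
    moreover have "?\<sigma> * (M - y t j) \<le> M - y t j"
      using le[OF that, of j] \<sigma> by (intro mult_left_le_one_le) auto
    ultimately show ?thesis by linarith
  qed
  define w' where "w' t i = exp (K * t) * (K * (M - y t i) + (\<Sum>j\<in>UNIV. a i j * sin (y t i - y t j)))" for t i
  have w': "((\<lambda>t. w t i) has_real_derivative w' t i) (at t within {0..})" if "0 \<le> t" for t i
  proof -
    have "(\<Sum>j\<in>UNIV. a i j * sin (y t j - y t i)) = - (\<Sum>j\<in>UNIV. a i j * sin (y t i - y t j))"
      unfolding sum_negf[symmetric] using sin_minus[of "y t i - y t _"] by (intro sum.cong) auto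
    then have "((\<lambda>t. y t i) has_real_derivative - (\<Sum>j\<in>UNIV. a i j * sin (y t i - y t j))) (at t within {0..})"
      using coupled_deriv[OF y that, of i] by simp
    then show ?thesis
      unfolding w_def w'_def by (auto intro!: derivative_eq_intros simp: algebra_simps)
  qed
  have w'_ge: "(\<Sum>j\<in>UNIV. ?\<sigma> * a i j * w t j) \<le> w' t i" if "0 \<le> t" for t i
  proof -
    have "(\<Sum>j\<in>UNIV. ?\<sigma> * a i j * (M - y t j)) - (\<Sum>j\<in>UNIV. a i j) * (M - y t i)
        = (\<Sum>j\<in>UNIV. a i j * (?\<sigma> * (M - y t j) - (M - y t i)))"
      unfolding sum_distrib_right sum_subtractf[symmetric]
      by (rule sum.cong) (auto simp: right_diff_distrib mult_ac)
    also have "\<dots> \<le> (\<Sum>j\<in>UNIV. a i j * sin (y t i - y t j))"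
      by (intro sum_mono mult_left_mono sin_ge that a)
    moreover have "(\<Sum>j\<in>UNIV. a i j) * (M - y t i) \<le> K * (M - y t i)"
      unfolding K_def using le[OF that, of i] a
      by (intro mult_right_mono member_le_sum[of i UNIV "\<lambda>i. \<Sum>j\<in>UNIV. a i j"]) (auto intro: sum_nonneg)
    ultimately have "(\<Sum>j\<in>UNIV. ?\<sigma> * a i j * (M - y t j))
        \<le> K * (M - y t i) + (\<Sum>j\<in>UNIV. a i j * sin (y t i - y t j))"
      by linarith
    then have "exp (K * t) * (\<Sum>j\<in>UNIV. ?\<sigma> * a i j * (M - y t j)) \<le> w' t i"
      unfolding w'_def by (rule mult_left_mono) simp
    then show ?thesis
      by (simp only: w_def sum_distrib_left mult_ac)
  qed
  have w'_edge: "?\<sigma> * a i j * w t j \<le> w' t i" if "0 \<le> t" for t i j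
  proof -
    have "?\<sigma> * a i j * w t j \<le> (\<Sum>j\<in>UNIV. ?\<sigma> * a i j * w t j)"
      using \<sigma>(1) a nonneg[OF that]
      by (intro member_le_sum[of j UNIV "\<lambda>j. ?\<sigma> * a i j * w t j"] mult_nonneg_nonneg) auto
    then show ?thesis using w'_ge[OF that, of i] by linarith
  qed
  have edge_nonneg: "0 \<le> ?\<sigma> * a i j * w t j" if "0 \<le> t" for t i j
    using \<sigma>(1) a nonneg[OF that] by (intro mult_nonneg_nonneg) auto
  show mono: "w s i \<le> w t i" if "0 \<le> s" "s \<le> t" for s t i
  proof -
    have "0 * (t - s) \<le> w t i - w s i"
      by (rule derivative_ge_imp_increment_ge[OF w' that])
         (use order_trans[OF edge_nonneg w'_edge] that in auto)
    then show ?thesis by simp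
  qed
  show "?\<sigma> * a i j * w t j \<le> w (t + 1) i" if "0 \<le> t"
  proof -
    have "?\<sigma> * a i j * w t j * ((t + 1) - t) \<le> w (t + 1) i - w t i"
    proof (rule derivative_ge_imp_increment_ge[OF w' that])
      fix r assume r: "t \<le> r" "r \<le> t + 1"
      have "?\<sigma> * a i j * w t j \<le> ?\<sigma> * a i j * w r j"
        using mono[OF that r(1)] \<sigma>(1) a by (intro mult_left_mono mult_nonneg_nonneg) auto
      then show "?\<sigma> * a i j * w t j \<le> w' r i"
        using w'_edge[of r i j] that r by linarith
    qed auto
    then show ?thesis using nonneg[OF that, of i] by simp
  qed
qed

text \<open>
  Along a path from \<open>i\<close> to \<open>k\<close> one unit of time per edge suffices to transport a fraction of the gap
  of \<open>k\<close> to \<open>i\<close>. The constants are the same for all trajectories and all \<open>M\<close>; this uniformity is what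
  permits iterating the estimate.
\<close>

lemma coupled_gap_reach:
  fixes a :: "'n::finite \<Rightarrow> 'n \<Rightarrow> real"
  assumes reach: "(i, k) \<in> {(i, j). 0 < a i j}\<^sup>*" and \<gamma>: "0 \<le> \<gamma>" "\<gamma> < pi"
  defines "K \<equiv> \<Sum>i\<in>UNIV. \<Sum>j\<in>UNIV. a i j"
  shows "\<exists>l::nat. \<exists>\<delta>>0. \<forall>y M t. coupled a y \<longrightarrow> osc (y 0) \<le> \<gamma> \<longrightarrow> (\<forall>j. y 0 j \<le> M) \<longrightarrow> real l \<le> t \<longrightarrow>
           \<delta> * (M - y 0 k) \<le> exp (K * t) * (M - y t i)"
  using reach
proof (induction rule: converse_rtrancl_induct)
  case base
  show ?case
  proof (intro exI[of _ "0::nat"] exI[of _ "1::real"] conjI allI impI)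
    fix y M t assume "coupled a y" "osc (y 0) \<le> \<gamma>" "\<forall>j. y 0 j \<le> M" "real 0 \<le> t"
    then show "1 * (M - y 0 k) \<le> exp (K * t) * (M - y t k)"
      using coupled_gap_mono[of a y \<gamma> M 0 t k] \<gamma> by (simp add: K_def)
  qed simp
next
  case (step i j)
  then obtain l \<delta> where \<delta>: "\<delta> > 0" and IH: "\<And>y M t. coupled a y \<Longrightarrow> osc (y 0) \<le> \<gamma> \<Longrightarrow> (\<forall>j. y 0 j \<le> M) \<Longrightarrow>
      real l \<le> t \<Longrightarrow> \<delta> * (M - y 0 k) \<le> exp (K * t) * (M - y t j)"
    by blast
  have aij: "0 < a i j" using step.hyps by simp
  show ?case
  proof (intro exI[of _ "Suc l"] exI[of _ "sinc \<gamma> * a i j * \<delta>"] conjI allI impI)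
    show "0 < sinc \<gamma> * a i j * \<delta>"
      using \<delta> aij sinc_pos[OF \<gamma>] by (intro mult_pos_pos)
    fix y M t assume y: "coupled a y" "osc (y 0) \<le> \<gamma>" "\<forall>j. y 0 j \<le> M" and t: "real (Suc l) \<le> t"
    have "sinc \<gamma> * a i j * (\<delta> * (M - y 0 k)) \<le> sinc \<gamma> * a i j * (exp (K * (t - 1)) * (M - y (t - 1) j))"
      using IH[OF y, of "t - 1"] t aij sinc_pos[OF \<gamma>] by (intro mult_left_mono) auto
    also have "\<dots> \<le> exp (K * (t - 1 + 1)) * (M - y (t - 1 + 1) i)"
      unfolding K_def by (rule coupled_gap_edge[OF y(1) \<gamma> y(2)]) (use y t in auto)
    finally show "sinc \<gamma> * a i j * \<delta> * (M - y 0 k) \<le> exp (K * t) * (M - y t i)"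
      by (simp only: mult.assoc diff_add_cancel)
  qed
qed

lemma osc_uminus: "osc (\<lambda>i. - x i) = osc x"
proof (rule antisym)
  show "osc (\<lambda>i. - x i) \<le> osc x"
    unfolding osc_le_iff using diff_le_osc[of x] by (auto simp: algebra_simps)
  show "osc x \<le> osc (\<lambda>i. - x i)"
    unfolding osc_le_iff using diff_le_osc[of "\<lambda>i. - x i"] by (auto simp: algebra_simps)
qed

text \<open>
  After time \<open>N\<close> every angle stays below the initial maximum by a fraction of the initial gap between
  \<open>k\<close> and the maximum and, by the symmetry \<open>y \<mapsto> - y\<close>, above the initial minimum by a fraction of the
  gap between \<open>k\<close> and the minimum. The two gaps add up to the whole spread, wherever \<open>k\<close> lies.
\<close>

lemma coupled_contraction:
  fixes a :: "'n::finite \<Rightarrow> 'n \<Rightarrow> real"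
  assumes reach: "\<And>i. (i, k) \<in> {(i, j). 0 < a i j}\<^sup>*" and \<gamma>: "0 \<le> \<gamma>" "\<gamma> < pi"
  obtains N :: nat and \<beta> :: real where "0 < N" "0 < \<beta>" "\<beta> < 1"
    "\<And>y. coupled a y \<Longrightarrow> osc (y 0) \<le> \<gamma> \<Longrightarrow> osc (y (real N)) \<le> (1 - \<beta>) * osc (y 0)"
proof -
  define K where "K = (\<Sum>i\<in>UNIV. \<Sum>j\<in>UNIV. a i j)"
  have "\<forall>i. \<exists>l::nat. \<exists>\<delta>>0. \<forall>y M t. coupled a y \<longrightarrow> osc (y 0) \<le> \<gamma> \<longrightarrow> (\<forall>j. y 0 j \<le> M) \<longrightarrow> real l \<le> t \<longrightarrow>
           \<delta> * (M - y 0 k) \<le> exp (K * t) * (M - y t i)"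
    using coupled_gap_reach[OF reach \<gamma>] unfolding K_def by blast
  then obtain l :: "'n \<Rightarrow> nat" and \<delta> :: "'n \<Rightarrow> real" where \<delta>: "\<And>i. 0 < \<delta> i"
    and gap: "\<And>i y M t. coupled a y \<Longrightarrow> osc (y 0) \<le> \<gamma> \<Longrightarrow> (\<forall>j. y 0 j \<le> M) \<Longrightarrow> real (l i) \<le> t \<Longrightarrow>
           \<delta> i * (M - y 0 k) \<le> exp (K * t) * (M - y t i)"
    by metis
  define N where "N = Suc (\<Sum>i\<in>UNIV. l i)"
  have lN: "real (l i) \<le> real N" for i
    unfolding of_nat_le_iff using member_le_sum[of i UNIV l] by (simp add: N_def)
  \<comment> \<open>The cap \<open>1/2\<close> only ensures \<open>\<beta> < 1\<close>.\<close>
  define \<beta> where "\<beta> = min (1/2) (exp (- (K * N)) * Min (range \<delta>))"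
  have "0 < \<beta>"
    using \<delta> by (auto simp: \<beta>_def)
  have "\<beta> < 1"
    by (simp add: \<beta>_def min_def)
  have \<beta>_le: "\<beta> \<le> exp (- (K * N)) * \<delta> i" for i
  proof -
    have "\<beta> \<le> exp (- (K * N)) * Min (range \<delta>)" by (simp add: \<beta>_def)
    also have "\<dots> \<le> exp (- (K * N)) * \<delta> i" by simp
    finally show ?thesis .
  qed
  have above: "\<beta> * (Max (range (y 0)) - y 0 k) \<le> Max (range (y 0)) - y (real N) i"
    if y: "coupled a y" "osc (y 0) \<le> \<gamma>" for y i
  proof -
    let ?M = "Max (range (y 0))"
    have "\<beta> * (?M - y 0 k) \<le> exp (- (K * N)) * \<delta> i * (?M - y 0 k)"
      by (intro mult_right_mono \<beta>_le) auto
    also have "\<dots> \<le> exp (- (K * N)) * (exp (K * N) * (?M - y (real N) i))"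
      using gap[OF y, of ?M i "real N"] lN by (auto simp: mult.assoc)
    also have "\<dots> = ?M - y (real N) i"
      by (simp add: mult.assoc[symmetric] exp_add[symmetric])
    finally show ?thesis .
  qed
  have "osc (y (real N)) \<le> (1 - \<beta>) * osc (y 0)" if y: "coupled a y" "osc (y 0) \<le> \<gamma>" for y
    unfolding osc_le_iff
  proof (intro allI)
    fix i j
    have eq: "Max (range (\<lambda>i. - y 0 i)) = - Min (range (y 0))"
      by (simp add: minus_Min_eq_Max image_image)
    have "\<beta> * (Max (range (\<lambda>i. - y 0 i)) - - y 0 k) \<le> Max (range (\<lambda>i. - y 0 i)) - - y (real N) j"
      using above[of "\<lambda>t i. - y t i" j] coupled_uminus[OF y(1)] y(2) by (simp only: osc_uminus)
    then have "\<beta> * (y 0 k - Min (range (y 0))) \<le> y (real N) j - Min (range (y 0))"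
      unfolding eq by (simp add: algebra_simps del: minus_Min_eq_Max)
    moreover have "\<beta> * (Max (range (y 0)) - y 0 k) + \<beta> * (y 0 k - Min (range (y 0))) = \<beta> * osc (y 0)"
      by (simp add: osc_def algebra_simps)
    ultimately have "y (real N) i - y (real N) j \<le> osc (y 0) - \<beta> * osc (y 0)"
      using above[OF y, of i] unfolding osc_def by linarith
    then show "y (real N) i - y (real N) j \<le> (1 - \<beta>) * osc (y 0)"
      by (simp add: algebra_simps)
  qed
  then show ?thesis
    using that[of N \<beta>] \<open>0 < \<beta>\<close> \<open>\<beta> < 1\<close> by (simp add: N_def)
qed

lemma coupled_osc_decay:
  fixes a :: "'n::finite \<Rightarrow> 'n \<Rightarrow> real"
  assumes reach: "\<And>i. (i, k) \<in> {(i, j). 0 < a i j}\<^sup>*" and \<gamma>: "0 \<le> \<gamma>" "\<gamma> < pi"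
    and y: "coupled a y" and osc: "osc (y 0) \<le> \<gamma>"
  obtains C \<mu> :: real where "0 < \<mu>" "\<And>t. 0 \<le> t \<Longrightarrow> osc (y t) \<le> C * exp (- \<mu> * t)"
proof -
  obtain N :: nat and \<beta> :: real where N: "0 < N" and \<beta>: "0 < \<beta>" "\<beta> < 1" and
    contr: "\<And>y. coupled a y \<Longrightarrow> osc (y 0) \<le> \<gamma> \<Longrightarrow> osc (y (real N)) \<le> (1 - \<beta>) * osc (y 0)"
    using coupled_contraction[OF reach \<gamma>] by metis
  have small: "osc (y t) \<le> \<gamma>" if "0 \<le> t" for t
    using coupled_osc_antimono[OF y, of 0 t] osc \<gamma> that by simp
  have iter: "osc (y (real n * real N)) \<le> (1 - \<beta>) ^ n * osc (y 0)" for n :: nat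
  proof (induction n)
    case (Suc n)
    have "osc (y (real n * real N + real N)) \<le> (1 - \<beta>) * osc (y (real n * real N))"
      using contr[OF coupled_shift[OF y, of "real n * real N"]] small by simp
    also have "\<dots> \<le> (1 - \<beta>) * ((1 - \<beta>) ^ n * osc (y 0))"
      using Suc \<beta> by (intro mult_left_mono) auto
    finally show ?case by (simp add: algebra_simps)
  qed simp
  define \<mu> where "\<mu> = - ln (1 - \<beta>) / N"
  have "0 < \<mu>"
    unfolding \<mu>_def using \<beta> N by (intro divide_pos_pos) auto
  have "osc (y t) \<le> osc (y 0) / (1 - \<beta>) * exp (- \<mu> * t)" if "0 \<le> t" for t
  proof -
    define n where "n = nat \<lfloor>t / N\<rfloor>"
    have n: "real n \<le> t / N" "t / N < real n + 1"
      using that N by (auto simp: n_def)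
    have "osc (y t) \<le> osc (y (real n * real N))"
      using n(1) N small[of "real n * real N"] \<gamma> by (intro coupled_osc_antimono[OF y]) (auto simp: field_simps)
    also have "\<dots> \<le> (1 - \<beta>) ^ n * osc (y 0)"
      by (rule iter)
    also have "\<dots> \<le> (1 - \<beta>) powr (t / N - 1) * osc (y 0)"
      using \<beta> n osc_nonneg[of "y 0"]
      by (intro mult_right_mono) (auto simp flip: powr_realpow intro!: powr_mono')
    also have "(1 - \<beta>) powr (t / N - 1) = exp (- \<mu> * t - ln (1 - \<beta>))"
      using \<beta> by (simp add: powr_def \<mu>_def field_simps)
    also have "\<dots> = exp (- \<mu> * t) / (1 - \<beta>)"
      using \<beta> by (simp add: exp_diff)
    finally show ?thesis by (simp add: field_simps)
  qed
  then show ?thesis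
    using that \<open>0 < \<mu>\<close> by blast
qed

text \<open>
  The intervals spanned by the angles are nested and shrink exponentially; the limit is their common
  point.
\<close>

lemma coupled_synchronizes:
  fixes a :: "'n::finite \<Rightarrow> 'n \<Rightarrow> real"
  assumes reach: "\<And>i. (i, k) \<in> {(i, j). 0 < a i j}\<^sup>*" and \<gamma>: "0 \<le> \<gamma>" "\<gamma> < pi"
    and y: "coupled a y" and osc: "osc (y 0) \<le> \<gamma>"
  obtains c C \<mu> :: real where "Min (range (y 0)) \<le> c" "c \<le> Max (range (y 0))"
    "0 < \<mu>" "\<And>t i. 0 \<le> t \<Longrightarrow> \<bar>y t i - c\<bar> \<le> C * exp (- \<mu> * t)"
proof -
  obtain C \<mu> :: real where C: "0 < \<mu>" "\<And>t. 0 \<le> t \<Longrightarrow> osc (y t) \<le> C * exp (- \<mu> * t)"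
    using coupled_osc_decay[OF reach \<gamma> y osc] by metis
  have small: "osc (y t) < pi" if "0 \<le> t" for t
    using coupled_osc_antimono[OF y, of 0 t] osc \<gamma> that by simp
  have nested: "Min (range (y s)) \<le> Max (range (y t))" if "0 \<le> s" "0 \<le> t" for s t
    using coupled_in_hull_later(1)[OF y small, of s "max s t"]
      coupled_in_hull_later(2)[OF y small, of t "max s t"] that by (meson max.cobounded1 max.cobounded2 order_trans)
  define c where "c = (SUP t\<in>{0..}. Min (range (y t)))"
  have lower: "Min (range (y t)) \<le> c" if "0 \<le> t" for t
    unfolding c_def using that nested[of _ 0] by (intro cSUP_upper bdd_aboveI2) auto
  have upper: "c \<le> Max (range (y t))" if "0 \<le> t" for t
    unfolding c_def using nested that by (intro cSUP_least) auto
  have "\<bar>y t i - c\<bar> \<le> C * exp (- \<mu> * t)" if "0 \<le> t" for t i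
    using lower[OF that] upper[OF that] C(2)[OF that] range_bounds[of "y t" i] unfolding osc_def
    by linarith
  then show ?thesis
    using that[of c \<mu> C] lower[of 0] upper[of 0] C(1) by simp
qed

section \<open>The second-smallest eigenvalue and the Rayleigh quotient\<close>

lemma quadratic_nonneg_imp_linear_zero:
  fixes a b :: real
  assumes "\<And>t. 0 \<le> 2 * t * a + t\<^sup>2 * b"
  shows "a = 0"
proof (rule ccontr)
  assume "a \<noteq> 0"
  define k where "k = 1 + \<bar>b\<bar>"
  have k: "k > 0" "b < k" by (auto simp: k_def)
  have "0 \<le> (2 * (- a / k) * a + (- a / k)\<^sup>2 * b) * k\<^sup>2"
    using assms[of "- a / k"] by simp
  also have "\<dots> = a\<^sup>2 * (b - 2 * k)"
    using k by (simp add: field_simps power2_eq_square)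
  also have "\<dots> < 0"
    using \<open>a \<noteq> 0\<close> k by (intro mult_pos_neg) auto
  finally show False by simp
qed

lemma insort_nth_0_le: "insort a xs ! 0 \<le> (a::real)"
  by (cases xs) auto

text \<open>
  Two insertions leave at least two entries that are at most the larger inserted value, whether or
  not the list is sorted; hence the bound on \<open>lambda2\<close> below needs only two known roots.
\<close>

lemma insort2_nth_1_le: "insort a (insort b xs) ! 1 \<le> max a (b::real)"
proof (cases xs)
  case (Cons y ys)
  then show ?thesis
    using insort_nth_0_le[of a ys] insort_nth_0_le[of b ys] insort_nth_0_le[of a "insort b ys"] insort_nth_0_le[of a "y # ys"]
    by auto
qed auto

lemma det_column_scale:
  fixes A :: "real^'n^'n"
  shows "det (\<chi> i j. if j = k then c * w $ i else A $ i $ j)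
       = c * det (\<chi> i j. if j = k then w $ i else A $ i $ j)"
proof -
  have "det (transpose (\<chi> i j. if j = k then c * w $ i else A $ i $ j))
      = det (\<chi> i. if i = k then c *s w else column i A)"
    by (rule arg_cong[of _ _ det]) (vector transpose_def column_def)
  also have "\<dots> = c * det (\<chi> i. if i = k then w else column i A)"
    by (rule det_row_mul)
  also have "(\<chi> i. if i = k then w else column i A)
      = transpose (\<chi> i j. if j = k then w $ i else A $ i $ j)"
    by (vector transpose_def column_def)
  finally show ?thesis by (simp only: det_transpose)
qed

lemma cramer_column:
  fixes A :: "real^'n^'n"
  assumes "A *v x = c *s w"
  shows "x $ k * det A = c * det (\<chi> i j. if j = k then w $ i else A $ i $ j)"
  using cramer_lemma[of k A x]
  unfolding assms vector_smult_component det_column_scale by (rule sym)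

lemma poly_det:
  fixes M :: "real poly^'n^'n"
  shows "poly (det M) r = det (\<chi> i j. poly (M $ i $ j) r)"
  by (simp add: det_def poly_sum poly_prod poly_mult)

lemma poly_charpoly: "poly (charpoly A) r = det (r *\<^sub>R mat 1 - A)"
  unfolding charpoly_def poly_det
  by (rule arg_cong[of _ _ det]) (simp add: vec_eq_iff mat_def)

text \<open>
  Cramer's rule is applied twice to \<open>M = r I - A\<close>. Since \<open>M u = (r - \<alpha>) u\<close>, replacing column \<open>k\<close> of
  \<open>M\<close> by \<open>u\<close> splits off a factor \<open>r - \<alpha>\<close>. The multiple of \<open>u\<close> that makes coordinate \<open>k\<close> vanish is
  then subtracted from \<open>v\<close>; the resulting vector \<open>x\<close> does not see the replaced column, and, up to a
  multiple of \<open>u\<close> which the new column absorbs, it is again scaled by \<open>r - \<beta>\<close>. For \<open>\<alpha> = \<beta>\<close>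
  this gives a root of multiplicity at least two.
\<close>

lemma eigenpair_dvd_charpoly:
  fixes A :: "real^'n^'n"
  assumes u: "A *v u = \<alpha> *s u" "u \<noteq> 0"
    and v: "A *v v = \<beta> *s v" "\<And>c. v \<noteq> c *s u"
  shows "[:- \<alpha>, 1:] * [:- \<beta>, 1:] dvd charpoly A"
proof -
  obtain k where k: "u $ k \<noteq> 0"
    using u(2) by (auto simp: vec_eq_iff)
  define d where "d = v $ k / u $ k"
  define x where "x = v - d *s u"
  have xk: "x $ k = 0"
    using k by (simp add: x_def d_def)
  obtain l where l: "x $ l \<noteq> 0"
    using v(2)[of d] by (auto simp: x_def vec_eq_iff)
  have lk: "l \<noteq> k" using l xk by auto
  define G :: "real poly^'n^'n" where
    "G = (\<chi> i j. if j = l then [:x $ i:] else if j = k then [:u $ i:]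
                 else (if i = j then [:0, 1:] else 0) - [:A $ i $ j:])"
  have "poly (smult (u $ k * x $ l) (charpoly A)) r
      = poly ([:- \<alpha>, 1:] * [:- \<beta>, 1:] * det G) r" for r
  proof -
    define M where "M = r *\<^sub>R mat 1 - A"
    define N where "N = (\<chi> i j. if j = k then u $ i else M $ i $ j)"
    have M: "M *v y = r *s y - A *v y" for y
      by (simp add: M_def matrix_vector_mult_diff_rdistrib scaleR_matrix_vector_assoc[symmetric]
            scalar_mult_eq_scaleR)
    have "M *v u = (r - \<alpha>) *s u"
      by (simp add: M u vec_eq_iff algebra_simps)
    from cramer_column[OF this, of k]
    have 1: "u $ k * det M = (r - \<alpha>) * det N"
      by (simp add: N_def)
    \<comment> \<open>The correction along \<open>axis k 1\<close>, which \<open>N\<close> maps to \<open>u\<close>, cancels the part of \<open>M x\<close> along \<open>u\<close>.\<close>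
    define y where "y = x - (d * (\<alpha> - \<beta>)) *s axis k 1"
    have Nx: "N *v x = M *v x"
      unfolding matrix_vector_mult_def N_def vec_eq_iff
      using xk by (auto intro!: sum.cong)
    have Nk: "N *v axis k 1 = u"
      by (simp add: matrix_vector_mult_basis column_def N_def vec_eq_iff)
    have "N *v y = M *v x - (d * (\<alpha> - \<beta>)) *s u"
      by (simp add: y_def matrix_vector_mult_diff_distrib vector_scalar_commute Nx Nk)
    also have "M *v x = (r - \<beta>) *s v - (d * (r - \<alpha>)) *s u"
      by (simp add: M x_def matrix_vector_mult_diff_distrib vector_scalar_commute u v
            vec_eq_iff algebra_simps)
    also have "\<dots> - (d * (\<alpha> - \<beta>)) *s u = (r - \<beta>) *s x"
      by (simp add: x_def vec_eq_iff algebra_simps)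
    finally have "y $ l * det N = (r - \<beta>) * det (\<chi> i j. if j = l then x $ i else N $ i $ j)"
      by (rule cramer_column)
    moreover have "y $ l = x $ l"
      using lk by (simp add: y_def axis_def)
    moreover have "poly (det G) r = det (\<chi> i j. if j = l then x $ i else N $ i $ j)"
      unfolding poly_det by (rule arg_cong[of _ _ det]) (simp add: vec_eq_iff G_def N_def M_def mat_def)
    ultimately have 2: "x $ l * det N = (r - \<beta>) * poly (det G) r"
      by simp
    have "u $ k * x $ l * det M = (r - \<alpha>) * ((r - \<beta>) * poly (det G) r)"
      using 1 unfolding 2[symmetric] by (metis mult.assoc mult.commute)
    then show ?thesis
      by (simp add: poly_charpoly M_def[symmetric] del: mult_pCons_left mult_pCons_right)
  qed
  then have "smult (u $ k * x $ l) (charpoly A) = [:- \<alpha>, 1:] * [:- \<beta>, 1:] * det G"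
    by (simp add: poly_eq_poly_eq_iff[symmetric] fun_eq_iff)
  then show ?thesis
    using k l by (metis dvd_smult_cancel dvd_triv_left mult_eq_0_iff)
qed

lemma lambda2_le_eigenvalues:
  fixes A :: "real^'n^'n"
  assumes "charpoly A \<noteq> 0" "[:- \<alpha>, 1:] * [:- \<beta>, 1:] dvd charpoly A"
  shows "lambda2 A \<le> max \<alpha> \<beta>"
proof -
  obtain q where q: "charpoly A = ([:- \<alpha>, 1:] * [:- \<beta>, 1:]) * q"
    using assms(2) by (elim dvdE)
  have "proots (charpoly A) = proots [:- \<alpha>, 1:] + proots [:- \<beta>, 1:] + proots q"
    using assms(1) unfolding q by (subst proots_mult; simp add: proots_mult del: mult_pCons_left mult_pCons_right)
  also have "\<dots> = add_mset \<alpha> (add_mset \<beta> (proots q))"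
    by simp
  finally show ?thesis
    unfolding lambda2_def using insort2_nth_1_le by simp
qed

text \<open>
  Minimizing the Rayleigh quotient over the unit vectors orthogonal to \<open>1\<close> yields, by symmetry of
  \<open>A\<close>, an eigenvector with eigenvalue \<open>\<mu>\<close>. Together with the kernel vector \<open>1\<close> this exhibits the two
  roots \<open>0\<close> and \<open>\<mu> \<ge> 0\<close> of the characteristic polynomial, so its second-smallest root is at most
  \<open>\<mu>\<close>.
\<close>

lemma lambda2_le_rayleigh:
  fixes A :: "real^'n^'n"
  assumes sym: "\<And>x y. x \<bullet> (A *v y) = (A *v x) \<bullet> y"
    and psd: "\<And>x. 0 \<le> x \<bullet> (A *v x)"
    and ker: "A *v 1 = 0"
    and x: "x \<bullet> 1 = 0"
  shows "lambda2 A * (norm x)\<^sup>2 \<le> x \<bullet> (A *v x)"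
proof (cases "x = 0")
  case False
  define S where "S = {y :: real^'n. norm y = 1 \<and> y \<bullet> 1 = 0}"
  have "compact S"
  proof -
    have "S = sphere 0 1 \<inter> {y. y \<bullet> 1 = 0}" by (auto simp: S_def)
    moreover have "closed {y :: real^'n. y \<bullet> 1 = 0}"
      by (intro closed_Collect_eq continuous_intros)
    ultimately show ?thesis by (simp add: compact_Int_closed)
  qed
  moreover have unit: "y /\<^sub>R norm y \<in> S" if "y \<noteq> 0" "y \<bullet> 1 = 0" for y
    using that by (simp add: S_def)
  moreover have "continuous_on S (\<lambda>y. y \<bullet> (A *v y))"
    by (intro continuous_intros matrix_vector_mult_linear_continuous_on)
  ultimately obtain v where v: "v \<in> S" and min: "\<And>y. y \<in> S \<Longrightarrow> v \<bullet> (A *v v) \<le> y \<bullet> (A *v y)"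
    using continuous_attains_inf[of S "\<lambda>y. y \<bullet> (A *v y)"] False x by blast
  define \<mu> where "\<mu> = v \<bullet> (A *v v)"
  have v1: "v \<bullet> v = 1" "v \<bullet> 1 = 0"
    using v by (auto simp: S_def norm_eq_1)
  have ray: "\<mu> * (y \<bullet> y) \<le> y \<bullet> (A *v y)" if "y \<bullet> 1 = 0" for y
  proof (cases "y = 0")
    case False
    have "\<mu> \<le> (y /\<^sub>R norm y) \<bullet> (A *v (y /\<^sub>R norm y))"
      unfolding \<mu>_def by (rule min, rule unit) fact+
    also have "\<dots> = (y \<bullet> (A *v y)) / (y \<bullet> y)"
      by (simp add: matrix_vector_mult_scaleR power2_norm_eq_inner[symmetric] power2_eq_square field_simps)
    finally show ?thesis
      using False by (simp add: field_simps)
  qed simp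
  \<comment> \<open>The residual \<open>w\<close> is itself an admissible direction, so minimality along \<open>v + t w\<close> forces \<open>w = 0\<close>.\<close>
  define w where "w = A *v v - \<mu> *\<^sub>R v"
  have w1: "w \<bullet> 1 = 0"
    using sym[of v 1] v1 by (simp add: w_def inner_diff_left ker)
  have "0 \<le> 2 * t * (w \<bullet> w) + t\<^sup>2 * (w \<bullet> (A *v w) - \<mu> * (w \<bullet> w))" for t
  proof -
    have "(v + t *\<^sub>R w) \<bullet> 1 = 0"
      using v1 w1 by (simp add: inner_add_left)
    from ray[OF this] have "0 \<le> (v + t *\<^sub>R w) \<bullet> (A *v (v + t *\<^sub>R w)) - \<mu> * ((v + t *\<^sub>R w) \<bullet> (v + t *\<^sub>R w))"
      by simp
    also have "\<dots> = 2 * t * (w \<bullet> (A *v v) - \<mu> * (w \<bullet> v)) + t\<^sup>2 * (w \<bullet> (A *v w) - \<mu> * (w \<bullet> w))"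
      using sym[of v w] v1
      by (simp add: matrix_vector_right_distrib matrix_vector_mult_scaleR inner_add_left inner_add_right
          \<mu>_def[symmetric] inner_commute[of v w] inner_commute[of "A *v v" w] algebra_simps power2_eq_square)
    also have "w \<bullet> (A *v v) - \<mu> * (w \<bullet> v) = w \<bullet> w"
      by (simp add: w_def inner_diff_right inner_diff_left)
    finally show ?thesis .
  qed
  then have "w \<bullet> w = 0"
    by (rule quadratic_nonneg_imp_linear_zero)
  then have eig: "A *v v = \<mu> *s v"
    by (simp add: w_def scalar_mult_eq_scaleR)
  \<comment> \<open>As \<open>A\<close> is positive semidefinite, \<open>- 1\<close> is not an eigenvalue.\<close>
  have "charpoly A \<noteq> 0"
  proof
    assume "charpoly A = 0"
    then have "det ((- 1) *\<^sub>R mat 1 - A) = 0"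
      using poly_charpoly[of A "- 1"] by simp
    then obtain y where y: "((- 1) *\<^sub>R mat 1 - A) *v y = 0" "y \<noteq> 0"
      by (metis invertible_det_nz invertible_left_inverse matrix_left_invertible_ker)
    have "y \<bullet> (A *v y) = - (y \<bullet> y)"
    proof -
      have "- y - A *v y = 0"
        using y(1) unfolding matrix_vector_mult_diff_rdistrib scaleR_matrix_vector_assoc[symmetric] by simp
      then have "A *v y = - y" by (simp add: algebra_simps eq_neg_iff_add_eq_0)
      then show ?thesis by simp
    qed
    moreover have "y \<bullet> y > 0" using y by simp
    ultimately show False using psd[of y] by linarith
  qed
  moreover have "[:- 0, 1:] * [:- \<mu>, 1:] dvd charpoly A"
  proof (rule eigenpair_dvd_charpoly)
    show "A *v 1 = 0 *s 1" by (simp add: ker)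
    show "(1 :: real^'n) \<noteq> 0" by simp
    show "A *v v = \<mu> *s v" by (fact eig)
    show "v \<noteq> c *s 1" for c
    proof
      assume "v = c *s 1"
      then have "v \<bullet> v = c * (v \<bullet> 1)" by (simp add: scalar_mult_eq_scaleR)
      then show False using v1 by simp
    qed
  qed
  ultimately have "lambda2 A \<le> max 0 \<mu>"
    by (rule lambda2_le_eigenvalues)
  also have "max 0 \<mu> = \<mu>" using psd[of v] by (simp add: \<mu>_def)
  finally have "lambda2 A * (norm x)\<^sup>2 \<le> \<mu> * (x \<bullet> x)"
    by (simp add: power2_norm_eq_inner mult_right_mono)
  also have "\<dots> \<le> x \<bullet> (A *v x)" by (rule ray[OF x])
  finally show ?thesis .
qed simp

section \<open>Energy decay for symmetric coupling\<close>

lemma laplacian_mult: "(laplacian P *v x) $ i = (\<Sum>j\<in>UNIV. P $ i $ j * (x $ i - x $ j))"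
proof -
  have "(laplacian P *v x) $ i
      = (\<Sum>j\<in>UNIV. (if i = j then (\<Sum>k\<in>UNIV. P $ i $ k) * x $ j else 0) - P $ i $ j * x $ j)"
    unfolding matrix_vector_mult_def laplacian_def diag_def
    by (auto simp: left_diff_distrib intro!: sum.cong)
  also have "\<dots> = (\<Sum>j\<in>UNIV. P $ i $ j) * x $ i - (\<Sum>j\<in>UNIV. P $ i $ j * x $ j)"
    by (simp add: sum_subtractf)
  finally show ?thesis
    by (simp add: right_diff_distrib sum_subtractf sum_distrib_right)
qed

lemma laplacian_mult_1: "laplacian P *v 1 = 0"
  by (simp add: vec_eq_iff laplacian_mult)

text \<open>
  Summation by parts for symmetric weights. With constant \<open>e\<close> it says that symmetric interactions
  cancel in total; with varying \<open>e\<close> it produces the quadratic form of the Laplacian.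
\<close>

lemma sum_symmetric_odd:
  fixes p :: "'n::finite \<Rightarrow> 'n \<Rightarrow> real"
  assumes "\<And>i j. p i j = p j i" "\<And>i j. g i j = - g j i"
  shows "2 * (\<Sum>i\<in>UNIV. e i * (\<Sum>j\<in>UNIV. p i j * g i j)) = (\<Sum>i\<in>UNIV. \<Sum>j\<in>UNIV. p i j * ((e i - e j) * g i j))"
proof -
  have "(\<Sum>i\<in>UNIV. e i * (\<Sum>j\<in>UNIV. p i j * g i j)) = (\<Sum>i\<in>UNIV. \<Sum>j\<in>UNIV. e i * (p i j * g i j))"
    by (simp add: sum_distrib_left)
  moreover have "\<dots> = (\<Sum>i\<in>UNIV. \<Sum>j\<in>UNIV. e j * (p j i * g j i))"
    by (rule sum.swap)
  moreover have "\<dots> = (\<Sum>i\<in>UNIV. \<Sum>j\<in>UNIV. - (e j * (p i j * g i j)))"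
  proof (intro sum.cong refl)
    fix i j show "e j * (p j i * g j i) = - (e j * (p i j * g i j))"
      using assms(1)[of j i] assms(2)[of j i] by simp
  qed
  ultimately have "2 * (\<Sum>i\<in>UNIV. e i * (\<Sum>j\<in>UNIV. p i j * g i j))
      = (\<Sum>i\<in>UNIV. \<Sum>j\<in>UNIV. e i * (p i j * g i j)) + (\<Sum>i\<in>UNIV. \<Sum>j\<in>UNIV. - (e j * (p i j * g i j)))"
    by linarith
  also have "\<dots> = (\<Sum>i\<in>UNIV. \<Sum>j\<in>UNIV. p i j * ((e i - e j) * g i j))"
    unfolding sum.distrib[symmetric] by (intro sum.cong refl) (simp add: algebra_simps)
  finally show ?thesis .
qed

lemma laplacian_form:
  assumes "P = transpose P"
  shows "x \<bullet> (laplacian P *v x) = (\<Sum>i\<in>UNIV. \<Sum>j\<in>UNIV. P $ i $ j * (x $ i - x $ j)\<^sup>2) / 2"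
proof -
  have "P $ i $ j = P $ j $ i" for i j
    using arg_cong[OF assms, of "\<lambda>P. P $ i $ j"] by (simp add: transpose_def)
  from sum_symmetric_odd[of "\<lambda>i j. P $ i $ j" "\<lambda>i j. x $ i - x $ j" "\<lambda>i. x $ i", OF this]
  show ?thesis
    by (simp add: inner_vec_def laplacian_mult power2_eq_square)
qed

lemma laplacian_inner_commute:
  assumes "P = transpose P"
  shows "x \<bullet> (laplacian P *v y) = (laplacian P *v x) \<bullet> y"
proof -
  have "transpose (laplacian P) = laplacian P"
    using assms by (auto simp: transpose_def laplacian_def diag_def vec_eq_iff)
  then show ?thesis
    using dot_lmul_matrix[of x "laplacian P" y] transpose_matrix_vector[of "laplacian P" x] by simp
qed

lemma cos_vangle: "x \<noteq> 0 \<Longrightarrow> y \<noteq> 0 \<Longrightarrow> cos (vangle x y) = x \<bullet> y / (norm x * norm y)"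
proof -
  have "\<bar>x \<bullet> y\<bar> \<le> norm x * norm y" by (rule Cauchy_Schwarz_ineq2)
  moreover assume "x \<noteq> 0" "y \<noteq> 0"
  ultimately have "\<bar>x \<bullet> y / (norm x * norm y)\<bar> \<le> 1" by (simp add: abs_mult)
  then show ?thesis unfolding vangle_def by (intro cos_arccos_abs)
qed

text \<open>
  The vector \<open>e\<close> only pairs with the component of \<open>u\<close> orthogonal to \<open>d\<close>, so by Cauchy-Schwarz its
  component along \<open>u\<close> has at most the fraction \<open>sin\<^sup>2\<close> of the angle between \<open>d\<close> and \<open>u\<close> of its squared norm.
\<close>

lemma norm_projection_ge:
  fixes e d u :: "'a::real_inner"
  assumes "e \<bullet> d = 0" "d \<noteq> 0" "u \<noteq> 0"
  shows "(cos (vangle d u))\<^sup>2 * (norm e)\<^sup>2 \<le> (norm (e - (e \<bullet> u / (u \<bullet> u)) *\<^sub>R u))\<^sup>2"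
proof -
  define u' where "u' = u - (d \<bullet> u / (d \<bullet> d)) *\<^sub>R d"
  have pos: "0 < d \<bullet> d" "0 < u \<bullet> u" using assms by auto
  have "(e \<bullet> u')\<^sup>2 \<le> (e \<bullet> e) * (u' \<bullet> u')" by (rule Cauchy_Schwarz_ineq)
  moreover have "e \<bullet> u' = e \<bullet> u" using assms by (simp add: u'_def inner_diff_right)
  moreover have "u' \<bullet> u' = u \<bullet> u - (d \<bullet> u)\<^sup>2 / (d \<bullet> d)"
    using pos by (simp add: u'_def inner_diff_right inner_diff_left inner_commute power2_eq_square field_simps)
  ultimately have "(e \<bullet> u)\<^sup>2 / (u \<bullet> u) \<le> (e \<bullet> e) * (u \<bullet> u - (d \<bullet> u)\<^sup>2 / (d \<bullet> d)) / (u \<bullet> u)"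
    using pos by (intro divide_right_mono) auto
  also have "\<dots> = e \<bullet> e - (d \<bullet> u)\<^sup>2 / ((d \<bullet> d) * (u \<bullet> u)) * (e \<bullet> e)"
    using pos by (simp add: field_simps)
  also have "(d \<bullet> u)\<^sup>2 / ((d \<bullet> d) * (u \<bullet> u)) = (cos (vangle d u))\<^sup>2"
    using assms by (simp add: cos_vangle power_divide power_mult_distrib power2_norm_eq_inner)
  finally have "(cos (vangle d u))\<^sup>2 * (e \<bullet> e) \<le> e \<bullet> e - (e \<bullet> u)\<^sup>2 / (u \<bullet> u)"
    by simp
  also have "\<dots> = (norm (e - (e \<bullet> u / (u \<bullet> u)) *\<^sub>R u))\<^sup>2"
    unfolding power2_norm_eq_inner using pos
    by (simp add: inner_diff_right inner_diff_left inner_commute power2_eq_square field_simps)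
  finally show ?thesis by (simp add: power2_norm_eq_inner)
qed

text \<open>
  The spectral bound is available on the complement of \<open>1\<close>, whereas the conserved weighted mean makes
  \<open>e\<close> orthogonal to \<open>D\<close>. Projecting \<open>e\<close> along \<open>1\<close> leaves the Laplacian form unchanged and costs the
  factor \<open>cos\<^sup>2\<close> of the angle between the two normals.
\<close>

lemma weighted_laplacian_rayleigh:
  fixes D e :: "real^'n"
  assumes D: "\<And>i. 0 < D $ i" and P: "\<And>i j. 0 \<le> P $ i $ j" "P = transpose P"
    and mean: "(\<Sum>i\<in>UNIV. D $ i * e $ i) = 0"
  shows "lambda2 (laplacian P) * (cos (vangle (diag D *v 1) 1))\<^sup>2 / D_max D * (\<Sum>i\<in>UNIV. D $ i * (e $ i)\<^sup>2)
       \<le> e \<bullet> (laplacian P *v e)"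
proof -
  let ?L = "laplacian P" and ?c = "(cos (vangle (diag D *v 1) 1))\<^sup>2" and ?W = "\<Sum>i\<in>UNIV. D $ i * (e $ i)\<^sup>2"
  have psd: "0 \<le> x \<bullet> (?L *v x)" for x
    using P by (auto simp: laplacian_form intro!: sum_nonneg)
  have Dmax: "D $ i \<le> D_max D" for i by (simp add: D_max_def)
  have Dpos: "0 < D_max D" using D[of undefined] Dmax[of undefined] by linarith
  have W: "0 \<le> ?W" using D by (intro sum_nonneg) (simp add: less_imp_le)
  have "?W \<le> (\<Sum>i\<in>UNIV. D_max D * (e $ i)\<^sup>2)"
    by (intro sum_mono mult_right_mono Dmax) auto
  also have "\<dots> = D_max D * (norm e)\<^sup>2"
    unfolding power2_norm_eq_inner by (simp add: inner_vec_def sum_distrib_left power2_eq_square)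
  finally have WD: "?W / D_max D \<le> (norm e)\<^sup>2"
    using Dpos by (simp add: field_simps)
  show ?thesis
  \<comment> \<open>For a single node \<open>lambda2\<close> is unspecified; if it is negative, nonnegativity of the form suffices.\<close>
  proof (cases "0 \<le> lambda2 ?L")
    case True
    have Dv: "diag D *v 1 = D"
      by (simp add: vec_eq_iff matrix_vector_mult_def diag_def)
    define s where "s = e \<bullet> 1 / ((1::real^'n) \<bullet> 1)"
    define f where "f = e - s *\<^sub>R 1"
    have f1: "f \<bullet> 1 = 0"
    proof -
      have "(1::real^'n) \<bullet> 1 \<noteq> 0" by simp
      then show ?thesis by (simp add: f_def s_def inner_diff_left del: inner_eq_zero_iff)
    qed
    have "lambda2 ?L * ?c / D_max D * ?W = lambda2 ?L * (?c * (?W / D_max D))"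
      by simp
    also have "\<dots> \<le> lambda2 ?L * (?c * (norm e)\<^sup>2)"
      using True WD by (intro mult_left_mono) auto
    also have "\<dots> \<le> lambda2 ?L * (norm f)\<^sup>2"
    proof (rule mult_left_mono[OF _ True])
      have "e \<bullet> D = 0" using mean by (simp add: inner_vec_def mult.commute)
      moreover have "D \<noteq> 0" using D[of undefined] by auto
      ultimately show "?c * (norm e)\<^sup>2 \<le> (norm f)\<^sup>2"
        unfolding Dv f_def s_def by (rule norm_projection_ge) simp
    qed
    also have "\<dots> \<le> f \<bullet> (?L *v f)"
      by (intro lambda2_le_rayleigh laplacian_inner_commute P psd laplacian_mult_1 f1)
    also have "\<dots> = e \<bullet> (?L *v e)"
      by (simp add: laplacian_form[OF P(2)] f_def)
    finally show ?thesis .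
  next
    case False
    then have "lambda2 ?L * ?c / D_max D * ?W \<le> 0"
      using Dpos W by (intro mult_nonpos_nonneg divide_nonpos_nonneg) auto
    also have "\<dots> \<le> e \<bullet> (?L *v e)" by (rule psd)
    finally show ?thesis .
  qed
qed

lemma coupled_weighted_mean:
  fixes D :: "real^'n"
  assumes D: "\<And>i. 0 < D $ i" and P: "P = transpose P"
    and y: "coupled (\<lambda>i j. P $ i $ j / D $ i) y" and t: "0 \<le> t"
  shows "(\<Sum>i\<in>UNIV. D $ i * y t i) = (\<Sum>i\<in>UNIV. D $ i * y 0 i)"
proof -
  have sym: "P $ i $ j = P $ j $ i" for i j
    using arg_cong[OF P, of "\<lambda>P. P $ i $ j"] by (simp add: transpose_def)
  have "((\<lambda>t. \<Sum>i\<in>UNIV. D $ i * y t i) has_real_derivative 0) (at t within {0..})" if "0 \<le> t" for t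
  proof -
    have "((\<lambda>t. \<Sum>i\<in>UNIV. D $ i * y t i) has_real_derivative
        (\<Sum>i\<in>UNIV. D $ i * (\<Sum>j\<in>UNIV. P $ i $ j / D $ i * sin (y t j - y t i)))) (at t within {0..})"
      by (intro DERIV_sum DERIV_cmult coupled_deriv[OF y that])
    also have "(\<Sum>i\<in>UNIV. D $ i * (\<Sum>j\<in>UNIV. P $ i $ j / D $ i * sin (y t j - y t i)))
        = (\<Sum>i\<in>UNIV. 1 * (\<Sum>j\<in>UNIV. P $ i $ j * sin (y t j - y t i)))"
      using D by (auto simp: sum_distrib_left less_imp_neq[THEN not_sym] intro!: sum.cong)
    also have "\<dots> = 0"
      using sum_symmetric_odd[of "\<lambda>i j. P $ i $ j" "\<lambda>i j. sin (y t j - y t i)" "\<lambda>_. 1", OF sym sin_diff_swap]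
      by simp
    finally show ?thesis .
  qed
  then obtain c where "\<And>t. 0 \<le> t \<Longrightarrow> (\<Sum>i\<in>UNIV. D $ i * y t i) = c"
    using has_field_derivative_zero_constant[of "{0..}" "\<lambda>t. \<Sum>i\<in>UNIV. D $ i * y t i"] by auto
  then show ?thesis using t by simp
qed

text \<open>
  The derivative of the weighted energy is, after summation by parts, minus a double sum of
  \<open>P $ i $ j * d * sin d\<close> over the phase differences \<open>d\<close>. As \<open>\<bar>d\<bar> \<le> \<gamma>\<close> for all times, this is at most
  \<open>- 2 * sinc \<gamma>\<close> times the Laplacian form, and the Rayleigh bound closes a linear differential
  inequality.
\<close>

lemma coupled_energy_decay:
  fixes D :: "real^'n"
  assumes D: "\<And>i. 0 < D $ i" and P: "\<And>i j. 0 \<le> P $ i $ j" "P = transpose P" and \<gamma>: "0 \<le> \<gamma>" "\<gamma> < pi"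
    and y: "coupled (\<lambda>i j. P $ i $ j / D $ i) y" and osc: "osc (y 0) \<le> \<gamma>"
    and mean: "(\<Sum>i\<in>UNIV. D $ i * (y 0 i - c)) = 0" and t: "0 \<le> t"
  shows "(\<Sum>i\<in>UNIV. D $ i * (y t i - c)\<^sup>2)
       \<le> (\<Sum>i\<in>UNIV. D $ i * (y 0 i - c)\<^sup>2) * exp (2 * lambda_ps D P \<gamma> * t)"
proof -
  define W where "W t = (\<Sum>i\<in>UNIV. D $ i * (y t i - c)\<^sup>2)" for t
  define S where "S t = (\<Sum>i\<in>UNIV. (y t i - c) * (\<Sum>j\<in>UNIV. P $ i $ j * sin (y t j - y t i)))" for t
  let ?\<kappa> = "2 * lambda_ps D P \<gamma>"
  have sym: "P $ i $ j = P $ j $ i" for i j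
    using arg_cong[OF P(2), of "\<lambda>P. P $ i $ j"] by (simp add: transpose_def)
  have W': "(W has_real_derivative 2 * S t) (at t within {0..})" if "0 \<le> t" for t
  proof -
    have "(W has_real_derivative
        (\<Sum>i\<in>UNIV. D $ i * (2 * (y t i - c) * (\<Sum>j\<in>UNIV. P $ i $ j / D $ i * sin (y t j - y t i))))) (at t within {0..})"
      unfolding W_def
      by (intro DERIV_sum DERIV_cmult) (auto intro!: derivative_eq_intros coupled_deriv[OF y that])
    also have "(\<Sum>i\<in>UNIV. D $ i * (2 * (y t i - c) * (\<Sum>j\<in>UNIV. P $ i $ j / D $ i * sin (y t j - y t i)))) = 2 * S t"
      using D by (auto simp: S_def sum_distrib_left less_imp_neq[THEN not_sym] intro!: sum.cong)
    finally show ?thesis .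
  qed
  have S_le: "2 * S t \<le> ?\<kappa> * W t" if "0 \<le> t" for t
  proof -
    define e :: "real^'n" where "e = (\<chi> i. y t i - c)"
    have e0: "(\<Sum>i\<in>UNIV. D $ i * e $ i) = 0"
      using coupled_weighted_mean[OF D P(2) y that] mean
      by (simp add: e_def right_diff_distrib sum_subtractf)
    have "2 * S t = (\<Sum>i\<in>UNIV. \<Sum>j\<in>UNIV. P $ i $ j * ((y t i - c - (y t j - c)) * sin (y t j - y t i)))"
      unfolding S_def by (intro sum_symmetric_odd sym sin_diff_swap)
    also have "\<dots> \<le> (\<Sum>i\<in>UNIV. \<Sum>j\<in>UNIV. P $ i $ j * (- sinc \<gamma> * (e $ i - e $ j)\<^sup>2))"
    proof (intro sum_mono mult_left_mono P(1))
      fix i j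
      have "osc (y t) \<le> \<gamma>"
        using coupled_osc_antimono[OF y, of 0 t] osc \<gamma> that by simp
      then have "\<bar>y t i - y t j\<bar> \<le> \<gamma>"
        using diff_le_osc[of "y t" i j] diff_le_osc[of "y t" j i] by linarith
      then have "sinc \<gamma> * (y t i - y t j)\<^sup>2 \<le> (y t i - y t j) * sin (y t i - y t j)"
        using \<gamma> by (rule_tac mult_sin_ge_chord)
      moreover have "sin (y t j - y t i) = - sin (y t i - y t j)"
        by (rule sin_diff_swap)
      ultimately show "(y t i - c - (y t j - c)) * sin (y t j - y t i) \<le> - sinc \<gamma> * (e $ i - e $ j)\<^sup>2"
        by (simp only: e_def vec_lambda_beta) simp
    qed
    also have "\<dots> = - 2 * sinc \<gamma> * (e \<bullet> (laplacian P *v e))"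
      unfolding laplacian_form[OF P(2)] by (simp only: sum_distrib_left[symmetric] mult.left_commute[of _ "- sinc \<gamma>"])
    also have "\<dots> \<le> - 2 * sinc \<gamma> * (lambda2 (laplacian P) * (cos (vangle (diag D *v 1) 1))\<^sup>2 / D_max D * (\<Sum>i\<in>UNIV. D $ i * (e $ i)\<^sup>2))"
      using sinc_pos[OF \<gamma>] by (intro mult_left_mono_neg weighted_laplacian_rayleigh D P e0) simp
    also have "\<dots> = ?\<kappa> * W t"
    proof -
      have "- 2 * s * (l * q / d * w) = 2 * (- l * s * q / d) * w" for s l q d w :: real
        by simp
      then show ?thesis
        unfolding lambda_ps_def W_def e_def vec_lambda_beta .
    qed
    finally show ?thesis .
  qed
  have "0 * (t - 0) \<le> - (exp (- ?\<kappa> * t) * W t) - - (exp (- ?\<kappa> * 0) * W 0)"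
  proof (rule derivative_ge_imp_increment_ge)
    fix t :: real assume t: "0 \<le> t"
    show "((\<lambda>t. - (exp (- ?\<kappa> * t) * W t)) has_real_derivative exp (- ?\<kappa> * t) * (?\<kappa> * W t - 2 * S t)) (at t within {0..})"
      by (auto intro!: derivative_eq_intros W'[OF t] simp: algebra_simps)
    show "0 \<le> exp (- ?\<kappa> * t) * (?\<kappa> * W t - 2 * S t)"
      using S_le[OF t] by simp
  qed (use t in auto)
  then have "exp (- ?\<kappa> * t) * W t \<le> W 0" by simp
  then have "exp (?\<kappa> * t) * (exp (- ?\<kappa> * t) * W t) \<le> exp (?\<kappa> * t) * W 0"
    by (intro mult_left_mono) auto
  moreover have "exp (a * t) * (exp (- a * t) * w) = w" for a w :: real
    by (simp add: mult.assoc[symmetric] flip: exp_add)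
  ultimately have "W t \<le> W 0 * exp (?\<kappa> * t)"
    by (simp only: mult.commute[of "W 0"])
  then show ?thesis
    unfolding W_def .
qed

section \<open>Synchronization\<close>

text \<open>
  The time is chosen so that already the linear lower bound \<open>1 + \<mu> t\<close> of the exponential exceeds \<open>B / K\<close>.
\<close>

lemma exp_decay_bound_nonpos:
  fixes K B \<mu> :: real
  assumes "0 < \<mu>" and bound: "\<And>t. 0 \<le> t \<Longrightarrow> K \<le> B * exp (- \<mu> * t)"
  shows "K \<le> 0"
proof (rule ccontr)
  assume "\<not> K \<le> 0"
  then have K: "0 < K" by simp
  then have B: "0 \<le> B" using bound[of 0] by simp
  define t where "t = B / (\<mu> * K)"
  have t: "0 \<le> t" using K B assms(1) by (simp add: t_def)
  have "K + B = K * (1 + \<mu> * t)" using K assms(1) by (simp add: t_def field_simps)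
  also have "\<dots> \<le> K * exp (\<mu> * t)"
    using K by (intro mult_left_mono exp_ge_add_one_self) auto
  also have "\<dots> \<le> B * exp (- \<mu> * t) * exp (\<mu> * t)"
    by (intro mult_right_mono bound t) auto
  also have "\<dots> = B"
    by (simp add: mult.assoc exp_add[symmetric])
  finally show False using K by simp
qed

lemma kuramoto_solution_imp_coupled:
  fixes D \<omega> :: "real^'n"
  assumes D: "\<And>i. 0 < D $ i" and P: "\<And>i j. 0 \<le> P $ i $ j"
    and \<omega>: "\<And>i. \<omega> $ i / D $ i = \<omega>bar" and \<phi>: "\<And>i j. \<phi> $ i $ j = 0"
    and sol: "kuramoto_solution D \<omega> P \<phi> \<theta>"
  shows "coupled (\<lambda>i j. P $ i $ j / D $ i) (\<lambda>t i. \<theta> t $ i - \<omega>bar * t)"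
  unfolding coupled_def
proof (intro conjI allI impI)
  show "0 \<le> P $ i $ j / D $ i" for i j
    using D[of i] P[of i j] by simp
  fix t :: real and i assume t: "0 \<le> t"
  obtain \<theta>' where "(\<theta> has_vector_derivative \<theta>') (at t within {0..})"
    and eq: "D $ i * \<theta>' $ i = \<omega> $ i - (\<Sum>j\<in>UNIV. P $ i $ j * sin (\<theta> t $ i - \<theta> t $ j))"
    using sol t unfolding kuramoto_solution_def \<phi> by auto
  then have deriv: "((\<lambda>t. \<theta> t $ i) has_real_derivative \<theta>' $ i) (at t within {0..})"
    unfolding has_real_derivative_iff_has_vector_derivative
    by (intro bounded_linear.has_vector_derivative[OF bounded_linear_vec_nth])
  have "\<theta>' $ i = \<omega> $ i / D $ i - (\<Sum>j\<in>UNIV. P $ i $ j * sin (\<theta> t $ i - \<theta> t $ j)) / D $ i"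
    using eq D[of i] by (simp add: field_simps)
  also have "\<dots> = \<omega>bar + (\<Sum>j\<in>UNIV. P $ i $ j / D $ i * sin (\<theta> t $ j - \<theta> t $ i))"
    unfolding \<omega> sum_divide_distrib sin_diff_swap[of "\<theta> t $ i" "\<theta> t $ _"] by (simp add: sum_negf)
  finally have "(\<Sum>j\<in>UNIV. P $ i $ j / D $ i * sin (\<theta> t $ j - \<omega>bar * t - (\<theta> t $ i - \<omega>bar * t))) = \<theta>' $ i - \<omega>bar"
    by simp
  then show "((\<lambda>t. \<theta> t $ i - \<omega>bar * t) has_real_derivative
      (\<Sum>j\<in>UNIV. P $ i $ j / D $ i * sin (\<theta> t $ j - \<omega>bar * t - (\<theta> t $ i - \<omega>bar * t)))) (at t within {0..})"
    using deriv by (auto intro!: derivative_eq_intros)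
qed

theorem theoremV10:
  fixes D \<omega> :: "real ^ 'n"
    and P \<phi> :: "real ^ 'n ^ 'n"
    and \<omega>bar \<gamma> :: real
    and z\<^sub>0 :: "complex ^ 'n"
  assumes "\<And>i. D $ i > 0"
    and "\<And>i j. P $ i $ j \<ge> 0"
    and "\<And>i. P $ i $ i = 0"
    and "\<And>i j. \<phi> $ i $ j \<in> {0..<pi / 2}"
    and "\<exists>k. globally_reachable P k"
    and "phi_max \<phi> = 0"
    and "\<And>i. \<omega> $ i / D $ i = \<omega>bar"
    and "\<gamma> \<in> {0..<pi}"
    and "z\<^sub>0 \<in> Delta_bar \<gamma>"
  shows "(\<exists>x. half_circle_coords z\<^sub>0 x) \<and>
    (\<forall>\<theta>. kuramoto_solution D \<omega> P \<phi> \<theta> \<and> half_circle_coords z\<^sub>0 (\<theta> 0) \<longrightarrow>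
       (\<exists>c \<in> {angle_min (\<theta> 0)..angle_max (\<theta> 0)}.
          sync_exponentially \<theta> (\<lambda>t. c + \<omega>bar * t)) \<and>
       (P = transpose P \<longrightarrow>
          sync_exponentially \<theta> (\<lambda>t. weighted_mean D (\<theta> 0) + \<omega>bar * t) \<and>
          (\<exists>C. \<forall>t\<ge>0. norm (\<chi> i. \<theta> t $ i - (weighted_mean D (\<theta> 0) + \<omega>bar * t))
                 \<le> C * exp (lambda_ps D P \<gamma> * t))))"
proof (intro conjI allI impI; (elim conjE)?)
  have \<gamma>: "0 \<le> \<gamma>" "\<gamma> < pi" using assms(8) by auto
  obtain x :: "real^'n" where x: "\<And>i. cis (x $ i) = z\<^sub>0 $ i" "\<And>i j. x $ i - x $ j \<le> \<gamma>"
    using Delta_bar_coords[OF \<gamma> assms(9)] by metis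
  have "\<bar>x $ i - x $ j\<bar> < pi" for i j
    using x(2)[of i j] x(2)[of j i] \<gamma> by linarith
  with x(1) show "\<exists>x. half_circle_coords z\<^sub>0 x"
    unfolding half_circle_coords_def by blast

  fix \<theta> assume sol: "kuramoto_solution D \<omega> P \<phi> \<theta>" and hc: "half_circle_coords z\<^sub>0 (\<theta> 0)"
  have "\<phi> $ i $ j = 0" for i j
  proof -
    have "\<phi> $ i $ j \<le> phi_max \<phi>"
      unfolding phi_max_def by (rule Max_ge) (auto intro: rev_image_eqI[of "(i, j)"])
    then show ?thesis using assms(4)[of i j] assms(6) by simp
  qed
  note y = kuramoto_solution_imp_coupled[OF assms(1,2,7) this sol]
  define y where "y t i = \<theta> t $ i - \<omega>bar * t" for t i
  note y = y[folded y_def]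
  have y0: "y 0 = ($) (\<theta> 0)" by (simp add: y_def fun_eq_iff)
  have osc: "osc (y 0) \<le> \<gamma>"
    unfolding osc_le_iff y0 using half_circle_coords_osc[OF \<gamma> assms(9) hc] by simp
  obtain k where k: "globally_reachable P k" using assms(5) by blast
  have edges: "{(i, j). 0 < P $ i $ j / D $ i} = graph_edges P"
  proof -
    have "0 < P $ i $ j / D $ i \<longleftrightarrow> 0 < P $ i $ j" for i j
      using assms(1)[of i] by (simp add: zero_less_divide_iff)
    then show ?thesis by (simp add: graph_edges_def)
  qed
  have reach: "(i, k) \<in> {(i, j). 0 < P $ i $ j / D $ i}\<^sup>*" for i
    using k unfolding edges globally_reachable_def by (cases "i = k") (auto intro: trancl_into_rtrancl)
  obtain c C \<mu> where c: "Min (range (y 0)) \<le> c" "c \<le> Max (range (y 0))"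
    and \<mu>: "0 < \<mu>" and conv: "\<And>t i. 0 \<le> t \<Longrightarrow> \<bar>y t i - c\<bar> \<le> C * exp (- \<mu> * t)"
    using coupled_synchronizes[OF reach \<gamma> y osc] by metis
  have sync: "sync_exponentially \<theta> (\<lambda>t. c + \<omega>bar * t)"
    unfolding sync_exponentially_def
    using \<mu> conv by (intro allI exI[of _ C] exI[of _ \<mu>]) (auto simp: y_def algebra_simps)
  then show "\<exists>c\<in>{angle_min (\<theta> 0)..angle_max (\<theta> 0)}. sync_exponentially \<theta> (\<lambda>t. c + \<omega>bar * t)"
    using c unfolding y0 angle_min_def angle_max_def by auto

  assume sym: "P = transpose P"
  define m where "m = weighted_mean D (\<theta> 0)"
  have Dsum: "0 < (\<Sum>i\<in>UNIV. D $ i)"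
    using assms(1) by (intro sum_pos) auto
  have mean: "(\<Sum>i\<in>UNIV. D $ i * (y t i - b)) = (\<Sum>i\<in>UNIV. D $ i) * (m - b)" if "0 \<le> t" for t b
  proof -
    have "(\<Sum>i\<in>UNIV. D $ i * (y t i - b)) = (\<Sum>i\<in>UNIV. D $ i * y t i) - (\<Sum>i\<in>UNIV. D $ i) * b"
      by (simp add: right_diff_distrib sum_subtractf sum_distrib_right)
    also have "(\<Sum>i\<in>UNIV. D $ i * y t i) = (\<Sum>i\<in>UNIV. D $ i) * m"
      unfolding coupled_weighted_mean[OF assms(1) sym y that] y0 m_def weighted_mean_def
      using Dsum by simp
    finally show ?thesis by (simp add: right_diff_distrib)
  qed
  \<comment> \<open>The conserved weighted mean inherits the convergence of the angles, which identifies the limit.\<close>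
  have "\<bar>m - c\<bar> \<le> C * exp (- \<mu> * t)" if "0 \<le> t" for t
  proof -
    have "(\<Sum>i\<in>UNIV. D $ i) * \<bar>m - c\<bar> = \<bar>\<Sum>i\<in>UNIV. D $ i * (y t i - c)\<bar>"
      using Dsum by (simp add: mean[OF that] abs_mult)
    also have "\<dots> \<le> (\<Sum>i\<in>UNIV. \<bar>D $ i * (y t i - c)\<bar>)" by (rule sum_abs)
    also have "\<dots> \<le> (\<Sum>i\<in>UNIV. D $ i * (C * exp (- \<mu> * t)))"
    proof (rule sum_mono)
      fix i
      show "\<bar>D $ i * (y t i - c)\<bar> \<le> D $ i * (C * exp (- \<mu> * t))"
        unfolding abs_mult using assms(1)[of i] conv[OF that, of i] by (intro mult_mono) auto
    qed
    also have "\<dots> = (\<Sum>i\<in>UNIV. D $ i) * (C * exp (- \<mu> * t))" by (simp add: sum_distrib_right)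
    finally show ?thesis using Dsum by simp
  qed
  then have "\<bar>m - c\<bar> \<le> 0"
    by (rule exp_decay_bound_nonpos[OF \<mu>])
  then have "c = m" by simp
  with sync show "sync_exponentially \<theta> (\<lambda>t. weighted_mean D (\<theta> 0) + \<omega>bar * t)"
    by (simp add: m_def)

  \<comment> \<open>The energy dominates \<open>d\<close> times the squared Euclidean norm.\<close>
  define d where "d = Min (range (($) D))"
  have "d \<in> range (($) D)" unfolding d_def by (intro Min_in) auto
  then have d: "0 < d" using assms(1) by auto
  define W where "W t = (\<Sum>i\<in>UNIV. D $ i * (y t i - m)\<^sup>2)" for t
  have W0: "0 \<le> W 0"
    unfolding W_def using assms(1) by (intro sum_nonneg) (simp add: less_imp_le)
  have "norm (\<chi> i. \<theta> t $ i - (m + \<omega>bar * t)) \<le> sqrt (W 0 / d) * exp (lambda_ps D P \<gamma> * t)" if "0 \<le> t" for t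
  proof (rule power2_le_imp_le)
    have "d * (norm (\<chi> i. \<theta> t $ i - (m + \<omega>bar * t)))\<^sup>2 = (\<Sum>i\<in>UNIV. d * (y t i - m)\<^sup>2)"
      unfolding power2_norm_eq_inner
      by (simp add: inner_vec_def y_def sum_distrib_left power2_eq_square algebra_simps)
    also have "\<dots> \<le> W t"
      unfolding W_def d_def by (intro sum_mono mult_right_mono) auto
    also have "\<dots> \<le> W 0 * exp (2 * lambda_ps D P \<gamma> * t)"
      unfolding W_def using mean[of 0 m]
      by (intro coupled_energy_decay[OF assms(1,2) sym \<gamma> y osc _ that]) simp
    finally have "(norm (\<chi> i. \<theta> t $ i - (m + \<omega>bar * t)))\<^sup>2 \<le> W 0 / d * exp (2 * lambda_ps D P \<gamma> * t)"
      using d by (simp add: field_simps)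
    also have "\<dots> = (sqrt (W 0 / d) * exp (lambda_ps D P \<gamma> * t))\<^sup>2"
      using W0 d by (simp add: power_mult_distrib exp_double[symmetric] mult.assoc)
    finally show "(norm (\<chi> i. \<theta> t $ i - (m + \<omega>bar * t)))\<^sup>2 \<le> \<dots>" .
  qed (use W0 d in auto)
  then show "\<exists>C. \<forall>t\<ge>0. norm (\<chi> i. \<theta> t $ i - (weighted_mean D (\<theta> 0) + \<omega>bar * t))
      \<le> C * exp (lambda_ps D P \<gamma> * t)"
    unfolding m_def by blast
qed

end
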